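(* Let $\Lambda$ be a countable set of distinct real numbers and let $\mathcal{G}$ be an equivalence class in $\mathcal{F}_{B^2,\Lambda}/\overset{*}{\sim}$. Then $\mathcal{G}$ is sequentially compact with respect to the topology of $B^2(\mathbb{R},\mathbb{C})$.
   Context: For $1\le p<\infty$, the Besicovitch space $B^p(\mathbb{R},\mathbb{C})$ is the completion of the trigonometric polynomials $\sum_{j=1}^n a_je^{i\lambda_jt}$ ($a_j\in\mathbb{C}$, $\lambda_j\in\mathbb{R}$) with respect to the seminorm $\|f\|_{B^p}=\left(\limsup_{l\to\infty}\frac1{2l}\int_{-l}^{l}|f(t)|^p\,dt\right)^{1/p}$; concretely, it consists of the locally $p$-integrable $f:\mathbb{R}\to\mathbb{C}$ such that for every $\varepsilon>0$ there is a trigonometric polynomial $P$ with $\|f-P\|_{B^p}<\varepsilon$. The topology of $B^2(\mathbb{R},\mathbb{C})$ is that of the seminorm $\|\cdot\|_{B^2}$, and functions $f,g\in B^2(\mathbb{R},\mathbb{C})$ with $\|f-g\|_{B^2}=0$ are identified. For $f\in B^1(\mathbb{R},\mathbb{C})\supset B^2(\mathbb{R},\mathbb{C})$ the mean value $M(f)=\lim_{l\to\infty}\frac{1}{2l}\int_{-l}^{l}f(t)\,dt$ exists, and the Fourier coefficient at $\lambda\in\mathbb{R}$ is $a(f,\lambda)=M(f(t)e^{-i\lambda t})$, nonzero for at most countably many $\lambda$. For a countable set $\Lambda=\{\lambda_1,\lambda_2,\ldots\}$ of distinct real numbers (a set of exponents), $f$ is said to have Fourier series $\sum_{j\ge1}a_je^{i\lambda_jt}$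 if $a_j=a(f,\lambda_j)$ for all $j$ (zero values allowed) and $a(f,\lambda)=0$ for $\lambda\notin\Lambda$. $\mathcal{F}_{B^2,\Lambda}$ is the set of $f\in B^2(\mathbb{R},\mathbb{C})$ whose Fourier series is of this form. Equivalence relation: if $f_1,f_2$ have Fourier series $\sum_{j\ge1}a_je^{i\lambda_jt}$ and $\sum_{j\ge1}b_je^{i\lambda_jt}$ with $\lambda_j\in\Lambda$, then $f_1\overset{*}{\sim}f_2$ means that for each integer $n\ge1$ (with $n\le\sharp\Lambda$) there is a $\mathbb{Q}$-linear map $\psi_n:V_n\to\mathbb{R}$, where $V_n$ is the $\mathbb{Q}$-vector space generated by $\{\lambda_1,\ldots,\lambda_n\}$, such that $b_j=a_je^{i\psi_n(\lambda_j)}$ for $j=1,\ldots,n$. Sequentially compact means that every sequence in $\mathcal{G}$ has a subsequence converging in $B^2(\mathbb{R},\mathbb{C})$ to an element of $\mathcal{G}$. *)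

theory Defs
  imports "HOL-Analysis.Analysis"
begin

definition trig_polys :: "(real \<Rightarrow> complex) set" where
  "trig_polys = {P. \<exists>(n::nat) (a :: nat \<Rightarrow> complex) (\<mu> :: nat \<Rightarrow> real).
     P = (\<lambda>t. \<Sum>j=1..n. a j * cis (\<mu> j * t))}"

(* The p-th root is spelled out because powr is not available on ennreal. *)
definition besicovitch_seminorm :: "real \<Rightarrow> (real \<Rightarrow> complex) \<Rightarrow> ennreal" where
  "besicovitch_seminorm p f =
     (let L = Limsup at_top (\<lambda>l::real.
                (\<integral>\<^sup>+ t\<in>{-l..l}. ennreal (norm (f t) powr p) \<partial>lebesgue) / ennreal (2 * l))
      in if L = top then top else ennreal (enn2real L powr (1 / p)))"

definition locally_p_integrable :: "real \<Rightarrow> (real \<Rightarrow> complex) \<Rightarrow> bool" where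
  "locally_p_integrable p f \<longleftrightarrow>
     f \<in> borel_measurable lebesgue \<and>
     (\<forall>a b. set_integrable lebesgue {a..b} (\<lambda>t. norm (f t) powr p))"

(* Elements are functions rather than classes modulo seminorm-null functions. On these functions,
   Fourier coefficients, equivalence and convergence are unchanged by adding a seminorm-null
   function, so sets closed under the equivalence correspond to sets of such classes. *)
definition besicovitch_space :: "real \<Rightarrow> (real \<Rightarrow> complex) set" where
  "besicovitch_space p = {f. locally_p_integrable p f \<and>
     (\<forall>\<epsilon>>0. \<exists>P\<in>trig_polys. besicovitch_seminorm p (\<lambda>t. f t - P t) < ennreal \<epsilon>)}"

definition mean_value :: "(real \<Rightarrow> complex) \<Rightarrow> complex" where
  "mean_value f = Lim at_top (\<lambda>l::real.
     (set_lebesgue_integral lebesgue {-l..l} f) / complex_of_real (2 * l))"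

definition fourier_coeff :: "(real \<Rightarrow> complex) \<Rightarrow> real \<Rightarrow> complex" where
  "fourier_coeff f \<mu> = mean_value (\<lambda>t. f t * cis (- \<mu> * t))"

(* The set of n \<ge> 1 not exceeding the cardinality of \<Lambda> (which may be finite or infinite). *)
definition exponent_indices :: "real set \<Rightarrow> nat set" where
  "exponent_indices \<Lambda> = {n. 1 \<le> n \<and> (finite \<Lambda> \<longrightarrow> n \<le> card \<Lambda>)}"

definition enumerates_exponents :: "(nat \<Rightarrow> real) \<Rightarrow> real set \<Rightarrow> bool" where
  "enumerates_exponents lam \<Lambda> \<longleftrightarrow> bij_betw lam (exponent_indices \<Lambda>) \<Lambda>"

definition has_fourier_series ::
    "real set \<Rightarrow> (nat \<Rightarrow> real) \<Rightarrow> (real \<Rightarrow> complex) \<Rightarrow> (nat \<Rightarrow> complex) \<Rightarrow> bool" where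
  "has_fourier_series \<Lambda> lam f a \<longleftrightarrow>
     (\<forall>j\<in>exponent_indices \<Lambda>. a j = fourier_coeff f (lam j)) \<and>
     (\<forall>\<mu>. \<mu> \<notin> \<Lambda> \<longrightarrow> fourier_coeff f \<mu> = 0)"

definition besicovitch_exponents ::
    "real set \<Rightarrow> (nat \<Rightarrow> real) \<Rightarrow> (real \<Rightarrow> complex) set" where
  "besicovitch_exponents \<Lambda> lam =
     {f \<in> besicovitch_space 2. \<exists>a. has_fourier_series \<Lambda> lam f a}"

definition rat_scale :: "rat \<Rightarrow> real \<Rightarrow> real" where
  "rat_scale q x = of_rat q * x"

lemma vector_space_rat_scale: "vector_space rat_scale"
  by unfold_locales (auto simp: rat_scale_def algebra_simps of_rat_add of_rat_mult)

definition rat_span :: "real set \<Rightarrow> real set" where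
  "rat_span = module.span rat_scale"

definition rat_linear_on :: "real set \<Rightarrow> (real \<Rightarrow> real) \<Rightarrow> bool" where
  "rat_linear_on V \<psi> \<longleftrightarrow>
     (\<forall>x\<in>V. \<forall>y\<in>V. \<psi> (x + y) = \<psi> x + \<psi> y) \<and>
     (\<forall>q. \<forall>x\<in>V. \<psi> (rat_scale q x) = rat_scale q (\<psi> x))"

definition besicovitch_equiv ::
    "real set \<Rightarrow> (nat \<Rightarrow> real) \<Rightarrow> ((real \<Rightarrow> complex) \<times> (real \<Rightarrow> complex)) set" where
  "besicovitch_equiv \<Lambda> lam =
     {(f, g). f \<in> besicovitch_exponents \<Lambda> lam \<and> g \<in> besicovitch_exponents \<Lambda> lam \<and>
        (\<exists>a b. has_fourier_series \<Lambda> lam f a \<and> has_fourier_series \<Lambda> lam g b \<and>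
           (\<forall>n\<in>exponent_indices \<Lambda>. \<exists>\<psi>.
              rat_linear_on (rat_span (lam ` {1..n})) \<psi> \<and>
              (\<forall>j\<in>{1..n}. b j = a j * cis (\<psi> (lam j)))))}"

lemma exponent_indices_downward:
  assumes "n \<in> exponent_indices \<Lambda>" "j \<in> {1..n}"
  shows "j \<in> exponent_indices \<Lambda>"
  using assms by (auto simp: exponent_indices_def)

lemma besicovitch_equiv_iff:
  "(f, g) \<in> besicovitch_equiv \<Lambda> lam \<longleftrightarrow>
     f \<in> besicovitch_exponents \<Lambda> lam \<and> g \<in> besicovitch_exponents \<Lambda> lam \<and>
     (\<forall>n\<in>exponent_indices \<Lambda>. \<exists>\<psi>.
        rat_linear_on (rat_span (lam ` {1..n})) \<psi> \<and>
        (\<forall>j\<in>{1..n}. fourier_coeff g (lam j) = fourier_coeff f (lam j) * cis (\<psi> (lam j))))"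
  (is "?L \<longleftrightarrow> ?F \<and> ?G \<and> ?R")
proof
  assume ?L
  then obtain a b where fg: ?F ?G
    and a: "has_fourier_series \<Lambda> lam f a" and b: "has_fourier_series \<Lambda> lam g b"
    and ex: "\<forall>n\<in>exponent_indices \<Lambda>. \<exists>\<psi>. rat_linear_on (rat_span (lam ` {1..n})) \<psi> \<and>
              (\<forall>j\<in>{1..n}. b j = a j * cis (\<psi> (lam j)))"
    unfolding besicovitch_equiv_def by blast
  have ?R
  proof
    fix n assume n: "n \<in> exponent_indices \<Lambda>"
    with ex obtain \<psi> where \<psi>: "rat_linear_on (rat_span (lam ` {1..n})) \<psi>"
      "\<forall>j\<in>{1..n}. b j = a j * cis (\<psi> (lam j))" by blast
    then have "\<forall>j\<in>{1..n}. fourier_coeff g (lam j) = fourier_coeff f (lam j) * cis (\<psi> (lam j))"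
      using a b exponent_indices_downward[OF n] unfolding has_fourier_series_def by metis
    with \<psi> show "\<exists>\<psi>. rat_linear_on (rat_span (lam ` {1..n})) \<psi> \<and>
        (\<forall>j\<in>{1..n}. fourier_coeff g (lam j) = fourier_coeff f (lam j) * cis (\<psi> (lam j)))" by blast
  qed
  with fg show "?F \<and> ?G \<and> ?R" by blast
next
  assume R: "?F \<and> ?G \<and> ?R"
  then have "has_fourier_series \<Lambda> lam f (\<lambda>j. fourier_coeff f (lam j))"
    "has_fourier_series \<Lambda> lam g (\<lambda>j. fourier_coeff g (lam j))"
    by (auto simp: besicovitch_exponents_def has_fourier_series_def)
  with R show ?L unfolding besicovitch_equiv_def by blast
qed

lemma equiv_besicovitch_equiv:
  "equiv (besicovitch_exponents \<Lambda> lam) (besicovitch_equiv \<Lambda> lam)"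
proof (rule equivI)
  show "besicovitch_equiv \<Lambda> lam \<subseteq> besicovitch_exponents \<Lambda> lam \<times> besicovitch_exponents \<Lambda> lam"
    by (auto simp: besicovitch_equiv_def)
  show "refl_on (besicovitch_exponents \<Lambda> lam) (besicovitch_equiv \<Lambda> lam)"
    unfolding refl_on_def besicovitch_equiv_iff
    by (auto intro!: exI[of _ "\<lambda>_. 0"] simp: rat_linear_on_def rat_scale_def)
  show "sym (besicovitch_equiv \<Lambda> lam)"
  proof (rule symI)
    fix f g assume fg: "(f, g) \<in> besicovitch_equiv \<Lambda> lam"
    have "\<exists>\<psi>. rat_linear_on (rat_span (lam ` {1..n})) \<psi> \<and>
        (\<forall>j\<in>{1..n}. fourier_coeff f (lam j) = fourier_coeff g (lam j) * cis (\<psi> (lam j)))"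
      if n: "n \<in> exponent_indices \<Lambda>" for n
    proof -
      from fg n obtain \<psi> where "rat_linear_on (rat_span (lam ` {1..n})) \<psi>"
        "\<forall>j\<in>{1..n}. fourier_coeff g (lam j) = fourier_coeff f (lam j) * cis (\<psi> (lam j))"
        unfolding besicovitch_equiv_iff by blast
      then show ?thesis
        by (intro exI[of _ "\<lambda>x. - \<psi> x"])
           (auto simp: rat_linear_on_def rat_scale_def mult.assoc cis_mult)
    qed
    with fg show "(g, f) \<in> besicovitch_equiv \<Lambda> lam" unfolding besicovitch_equiv_iff by blast
  qed
  show "trans (besicovitch_equiv \<Lambda> lam)"
  proof (rule transI)
    fix f g h
    assume fg: "(f, g) \<in> besicovitch_equiv \<Lambda> lam" and gh: "(g, h) \<in> besicovitch_equiv \<Lambda> lam"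
    have "\<exists>\<psi>. rat_linear_on (rat_span (lam ` {1..n})) \<psi> \<and>
        (\<forall>j\<in>{1..n}. fourier_coeff h (lam j) = fourier_coeff f (lam j) * cis (\<psi> (lam j)))"
      if n: "n \<in> exponent_indices \<Lambda>" for n
    proof -
      from fg n obtain \<psi> where "rat_linear_on (rat_span (lam ` {1..n})) \<psi>"
        "\<forall>j\<in>{1..n}. fourier_coeff g (lam j) = fourier_coeff f (lam j) * cis (\<psi> (lam j))"
        unfolding besicovitch_equiv_iff by blast
      moreover from gh n obtain \<phi> where "rat_linear_on (rat_span (lam ` {1..n})) \<phi>"
        "\<forall>j\<in>{1..n}. fourier_coeff h (lam j) = fourier_coeff g (lam j) * cis (\<phi> (lam j))"
        unfolding besicovitch_equiv_iff by blast
      ultimately show ?thesis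
        by (intro exI[of _ "\<lambda>x. \<psi> x + \<phi> x"])
           (auto simp: rat_linear_on_def rat_scale_def mult.assoc cis_mult algebra_simps)
    qed
    with fg gh show "(f, h) \<in> besicovitch_equiv \<Lambda> lam" unfolding besicovitch_equiv_iff by blast
  qed
qed

definition besicovitch_seq_compact :: "real \<Rightarrow> (real \<Rightarrow> complex) set \<Rightarrow> bool" where
  "besicovitch_seq_compact p G \<longleftrightarrow> G \<subseteq> besicovitch_space p \<and>
     (\<forall>s :: nat \<Rightarrow> real \<Rightarrow> complex. (\<forall>n. s n \<in> G) \<longrightarrow>
        (\<exists>g\<in>G. \<exists>r :: nat \<Rightarrow> nat. strict_mono r \<and>
           (\<lambda>n. besicovitch_seminorm p (\<lambda>t. s (r n) t - g t)) \<longlonglongrightarrow> 0))"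

end

theory Submission
  imports Defs "HOL-Complex_Analysis.Great_Picard"
begin

text \<open>
  Functions in one equivalence class have the same moduli of Fourier coefficients, and only the
  phases vary. Given a sequence in the class, a diagonal argument over the countable set of exponents
  yields a subsequence whose coefficients converge one by one. Parseval's identity (\<open>parseval\<close>)
  upgrades this to the seminorm: the squared distance of two members is the sum of the squared
  differences of their coefficients, these are dominated by four times the squared moduli common to the
  class, and this majorant is summable, so the subsequence is Cauchy (\<open>Cauchy_if_coefficients_converge\<close>).
  Since \<open>B\<^sup>2\<close> is complete (\<open>besicovitch_space_complete\<close>) it has a limit \<open>g\<close>, whose Fourier coefficients are the
  limits of the coefficients.

  That \<open>g\<close> stays in the class is a separate, arithmetic matter. The phases are of the form \<open>cis (\<psi> x)\<close>
  for rational linear maps \<open>\<psi>\<close> on the span of finitely many exponents. The set of such phase tuples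
  is closed (\<open>rational_characters_seq_compact\<close>), although the maps \<open>\<psi>\<close> themselves can run off to infinity: the
  exponents are integer combinations of finitely many rationally independent numbers, so that
  the tuples depend only on angles modulo \<open>2 \<pi>\<close> and fill a continuous image of a torus.

  Parseval's identity rests on the fact that the partial Fourier sum over a finite set of frequencies
  is asymptotically the best approximation from that set (\<open>mean_square_partial_sum_minimal\<close>).
  Completeness is proved by gluing: mean values over \<open>[-l, l]\<close> for large \<open>l\<close> do not see bounded windows, so
  the increments of a fast Cauchy sequence may be erased on ever larger windows around zero and then
  added up (\<open>fast_cauchy_has_limit\<close>).
\<close>

section \<open>Root mean squares over symmetric intervals\<close>

definition interval_mean :: "real \<Rightarrow> (real \<Rightarrow> complex) \<Rightarrow> complex" where
  "interval_mean l f = set_lebesgue_integral lebesgue {-l..l} f / complex_of_real (2 * l)"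

definition mean_square :: "real \<Rightarrow> (real \<Rightarrow> complex) \<Rightarrow> real" where
  "mean_square l f = set_lebesgue_integral lebesgue {-l..l} (\<lambda>t. (norm (f t))\<^sup>2) / (2 * l)"

definition rms :: "real \<Rightarrow> (real \<Rightarrow> complex) \<Rightarrow> real" where
  "rms l f = sqrt (mean_square l f)"

abbreviation loc_L2 :: "(real \<Rightarrow> complex) \<Rightarrow> bool" where
  "loc_L2 \<equiv> locally_p_integrable 2"

lemma loc_L2_iff:
  "loc_L2 f \<longleftrightarrow> f \<in> borel_measurable lebesgue \<and>
     (\<forall>a b. set_integrable lebesgue {a..b} (\<lambda>t. (norm (f t))\<^sup>2))"
  by (simp add: locally_p_integrable_def)

lemma loc_L2_measurable [measurable_dest]: "loc_L2 f \<Longrightarrow> f \<in> borel_measurable lebesgue"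
  by (simp add: loc_L2_iff)

lemma loc_L2_square_integrable:
  "loc_L2 f \<Longrightarrow> set_integrable lebesgue {a..b} (\<lambda>t. (norm (f t))\<^sup>2)"
  by (simp add: loc_L2_iff)

lemma set_integrable_dominated:
  fixes g :: "real \<Rightarrow> real" and f :: "real \<Rightarrow> 'a::{banach, second_countable_topology}"
  assumes "set_integrable lebesgue {a..b} g" "f \<in> borel_measurable lebesgue"
    and "\<And>t. t \<in> {a..b} \<Longrightarrow> norm (f t) \<le> g t"
  shows "set_integrable lebesgue {a..b} f"
proof (rule set_integrable_bound[OF assms(1)])
  have "(\<lambda>x. indicat_real {a..b} x *\<^sub>R f x) \<in> borel_measurable lebesgue"
    using borel_measurable_scaleR[OF borel_measurable_indicator assms(2), of "{a..b}"] by simp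
  then show "set_borel_measurable lebesgue {a..b} f"
    unfolding set_borel_measurable_def .
  show "AE x in lebesgue. x \<in> {a..b} \<longrightarrow> norm (f x) \<le> norm (g x)"
  proof (rule AE_I2, rule impI)
    fix x assume "x \<in> {a..b}"
    from assms(3)[OF this] show "norm (f x) \<le> norm (g x)" by simp
  qed
qed

text \<open>
  This is \<open>|x y| \<le> |x|\<^sup>2 + |y|\<^sup>2\<close>; it makes the inner product of two locally square integrable
  functions over a bounded interval meaningful.
\<close>

lemma loc_L2_product_integrable:
  assumes f: "loc_L2 f" and g: "loc_L2 g"
  shows "set_integrable lebesgue {a..b} (\<lambda>t. f t * cnj (g t))"
proof (rule set_integrable_dominated)
  show "set_integrable lebesgue {a..b} (\<lambda>t. (norm (f t))\<^sup>2 + (norm (g t))\<^sup>2)"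
    using f g by (intro set_integral_add loc_L2_square_integrable)
  note [measurable] = loc_L2_measurable[OF f] loc_L2_measurable[OF g]
  have "(\<lambda>t. cnj (g t)) \<in> borel_measurable lebesgue"
    by (rule measurable_compose[OF loc_L2_measurable[OF g]])
       (intro borel_measurable_continuous_onI continuous_intros)
  then show "(\<lambda>t. f t * cnj (g t)) \<in> borel_measurable lebesgue"
    by measurable
  fix t
  show "norm (f t * cnj (g t)) \<le> (norm (f t))\<^sup>2 + (norm (g t))\<^sup>2"
    using sum_squares_bound[of "norm (f t)" "norm (g t)"]
      mult_nonneg_nonneg[of "norm (f t)" "norm (g t)"]
    by (simp add: norm_mult del: mult_nonneg_nonneg)
qed

lemma norm_add_square_le: "(norm (x + y))\<^sup>2 \<le> 2 * (norm x)\<^sup>2 + 2 * (norm y)\<^sup>2"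
  for x y :: complex
proof -
  have "(norm (x + y))\<^sup>2 \<le> (norm x + norm y)\<^sup>2"
    by (intro power_mono norm_triangle_ineq) auto
  also have "\<dots> \<le> 2 * (norm x)\<^sup>2 + 2 * (norm y)\<^sup>2"
    using sum_squares_bound[of "norm x" "norm y"] by (simp add: power2_sum)
  finally show ?thesis .
qed

lemma loc_L2_add:
  assumes f: "loc_L2 f" and g: "loc_L2 g"
  shows "loc_L2 (\<lambda>t. f t + g t)"
  unfolding loc_L2_iff
proof (intro conjI allI)
  note [measurable] = loc_L2_measurable[OF f] loc_L2_measurable[OF g]
  show m: "(\<lambda>t. f t + g t) \<in> borel_measurable lebesgue" by measurable
  fix a b
  show "set_integrable lebesgue {a..b} (\<lambda>t. (norm (f t + g t))\<^sup>2)"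
  proof (rule set_integrable_dominated)
    show "set_integrable lebesgue {a..b} (\<lambda>t. 2 * (norm (f t))\<^sup>2 + 2 * (norm (g t))\<^sup>2)"
      using f g by (intro set_integral_add set_integrable_mult_right loc_L2_square_integrable)
    show "(\<lambda>t. (norm (f t + g t))\<^sup>2) \<in> borel_measurable lebesgue" by measurable
  qed (simp add: norm_add_square_le)
qed

lemma loc_L2_cmult:
  assumes f: "loc_L2 f"
  shows "loc_L2 (\<lambda>t. c * f t)"
  using f unfolding loc_L2_iff by (auto simp: norm_mult power_mult_distrib)

lemma loc_L2_diff: "loc_L2 f \<Longrightarrow> loc_L2 g \<Longrightarrow> loc_L2 (\<lambda>t. f t - g t)"
  using loc_L2_add[of f "\<lambda>t. - 1 * g t"] loc_L2_cmult[of g "- 1"] by simp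

lemma loc_L2_sum: "(\<And>i. i \<in> A \<Longrightarrow> loc_L2 (f i)) \<Longrightarrow> loc_L2 (\<lambda>t. \<Sum>i\<in>A. f i t)"
proof (induction A rule: infinite_finite_induct)
  case (insert x F)
  then show ?case using loc_L2_add[of "f x" "\<lambda>t. \<Sum>i\<in>F. f i t"] by simp
qed (auto simp: loc_L2_iff set_integrable_def)

lemma loc_L2_cis: "loc_L2 (\<lambda>t. cis (\<mu> * t))"
  by (auto simp: loc_L2_iff
      intro!: borel_measurable_continuous_onI measurable_completion continuous_intros
        absolutely_integrable_continuous_real)

lemma mean_square_nonneg: "l > 0 \<Longrightarrow> 0 \<le> mean_square l f"
  by (auto simp: mean_square_def set_lebesgue_integral_def intro!: divide_nonneg_pos Bochner_Integration.integral_nonneg)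

lemma rms_less_iff: "e \<ge> 0 \<Longrightarrow> rms l f < e \<longleftrightarrow> mean_square l f < e\<^sup>2"
  by (metis real_sqrt_less_iff real_sqrt_unique rms_def)

lemma rms_le_iff: "e \<ge> 0 \<Longrightarrow> rms l f \<le> e \<longleftrightarrow> mean_square l f \<le> e\<^sup>2"
  by (metis real_sqrt_le_iff real_sqrt_unique rms_def)

lemma rms_mono:
  assumes "loc_L2 f" "loc_L2 g" "l > 0" "\<And>t. t \<in> {-l..l} \<Longrightarrow> norm (f t) \<le> norm (g t)"
  shows "rms l f \<le> rms l g"
  unfolding rms_def mean_square_def using assms
  by (intro real_sqrt_le_mono divide_right_mono set_integral_mono loc_L2_square_integrable power_mono) auto

lemma rms_cong: "(\<And>t. t \<in> {-l..l} \<Longrightarrow> norm (f t) = norm (g t)) \<Longrightarrow> rms l f = rms l g"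
  unfolding rms_def mean_square_def
  by (intro arg_cong[where f = sqrt] arg_cong2[where f = "(/)"] set_lebesgue_integral_cong) auto

lemma rms_diff_commute: "rms l (\<lambda>t. f t - g t) = rms l (\<lambda>t. g t - f t)"
  by (intro rms_cong norm_minus_commute)

text \<open>
  Young's inequality with a free weight. Taking for \<open>A\<close> and \<open>B\<close> bounds for the root mean squares of
  two functions turns it, after integration, into Minkowski's inequality, because the right-hand side
  becomes \<open>(A + B)\<^sup>2\<close>.
\<close>

lemma weighted_square_bound:
  fixes x y :: complex
  assumes "A > 0" "B > 0"
  shows "(norm (x + y))\<^sup>2 \<le> (1 + B / A) * (norm x)\<^sup>2 + (1 + A / B) * (norm y)\<^sup>2"
proof -
  have "(norm (x + y))\<^sup>2 \<le> (norm x + norm y)\<^sup>2"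
    by (intro power_mono norm_triangle_ineq) auto
  moreover have "2 * norm x * norm y \<le> B / A * (norm x)\<^sup>2 + A / B * (norm y)\<^sup>2"
    using sum_squares_bound[of "sqrt (B / A) * norm x" "sqrt (A / B) * norm y"] assms
    by (simp add: power_mult_distrib real_sqrt_divide field_simps)
  ultimately show ?thesis by (simp add: power2_sum algebra_simps)
qed

lemma rms_triangle:
  assumes f: "loc_L2 f" and g: "loc_L2 g" and l: "l > 0"
  shows "rms l (\<lambda>t. f t + g t) \<le> rms l f + rms l g"
proof (rule field_le_epsilon)
  fix e :: real assume e: "e > 0"
  \<comment> \<open>the shift by e / 2 makes both weights positive\<close>
  define A B where "A = rms l f + e / 2" and "B = rms l g + e / 2"
  have pos: "A > 0" "B > 0"
    using e mean_square_nonneg[OF l, of f] mean_square_nonneg[OF l, of g] by (auto simp: A_def B_def rms_def add_nonneg_pos)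
  have AB: "mean_square l f \<le> A\<^sup>2" "mean_square l g \<le> B\<^sup>2"
    using pos e by (auto simp: A_def B_def simp flip: rms_le_iff)
  have "mean_square l (\<lambda>t. f t + g t) \<le>
      set_lebesgue_integral lebesgue {-l..l}
        (\<lambda>t. (1 + B / A) * (norm (f t))\<^sup>2 + (1 + A / B) * (norm (g t))\<^sup>2) / (2 * l)"
    unfolding mean_square_def using f g l pos
    by (intro divide_right_mono set_integral_mono loc_L2_square_integrable loc_L2_add
        set_integral_add set_integrable_mult_right weighted_square_bound) auto
  also have "\<dots> = (1 + B / A) * mean_square l f + (1 + A / B) * mean_square l g"
    unfolding mean_square_def
    using f g by (subst set_integral_add(2))
      (auto intro!: loc_L2_square_integrable simp: add_divide_distrib)
  also have "\<dots> \<le> (1 + B / A) * A\<^sup>2 + (1 + A / B) * B\<^sup>2"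
    using AB pos by (intro add_mono mult_left_mono) (auto intro!: add_nonneg_nonneg)
  also have "\<dots> = (A + B)\<^sup>2"
    using pos by (simp add: field_simps power2_eq_square)
  finally have "rms l (\<lambda>t. f t + g t) \<le> A + B"
    using pos by (simp add: rms_le_iff)
  then show "rms l (\<lambda>t. f t + g t) \<le> rms l f + rms l g + e"
    by (simp add: A_def B_def)
qed

lemma rms_triangle_diff:
  assumes "loc_L2 f" "loc_L2 g" "loc_L2 h" "l > 0"
  shows "rms l (\<lambda>t. f t - h t) \<le> rms l (\<lambda>t. f t - g t) + rms l (\<lambda>t. g t - h t)"
  using rms_triangle[OF loc_L2_diff[OF assms(1,2)] loc_L2_diff[OF assms(2,3)] assms(4)] by simp

lemma nn_mean_square:
  assumes f: "loc_L2 f" and "l > 0"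
  shows "(\<integral>\<^sup>+ t\<in>{-l..l}. ennreal (norm (f t) powr 2) \<partial>lebesgue) / ennreal (2 * l) =
    ennreal (mean_square l f)"
proof -
  have "(\<integral>\<^sup>+ t\<in>{-l..l}. ennreal (norm (f t) powr 2) \<partial>lebesgue) =
      ennreal (set_lebesgue_integral lebesgue {-l..l} (\<lambda>t. (norm (f t))\<^sup>2))"
    using loc_L2_square_integrable[OF f, of "-l" l]
    unfolding set_integrable_def set_lebesgue_integral_def
    by (subst nn_integral_eq_integral[symmetric])
       (auto intro!: nn_integral_cong split: split_indicator)
  then show ?thesis
    using \<open>l > 0\<close> unfolding mean_square_def
    by (simp add: divide_ennreal set_lebesgue_integral_def Bochner_Integration.integral_nonneg)
qed

lemma Limsup_mean_square:
  assumes f: "loc_L2 f"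
  shows "Limsup at_top (\<lambda>l::real.
       (\<integral>\<^sup>+ t\<in>{-l..l}. ennreal (norm (f t) powr 2) \<partial>lebesgue) / ennreal (2 * l))
     = Limsup at_top (\<lambda>l. ennreal (mean_square l f))"
  by (rule Limsup_eq, use eventually_gt_at_top[of 0] in eventually_elim)
     (rule nn_mean_square[OF f])

text \<open>
  The next two lemmas connect the seminorm, an upper limit of extended reals, with
  the real numbers \<open>rms l f\<close>. Later estimates compare these real numbers for
  large \<open>l\<close>.
\<close>

lemma eventually_rms_less:
  assumes f: "loc_L2 f" and e: "besicovitch_seminorm 2 f < ennreal e"
  shows "eventually (\<lambda>l. rms l f < e) at_top"
proof -
  define L where "L = Limsup at_top (\<lambda>l. ennreal (mean_square l f))"
  have e0: "e > 0" using e by (metis ennreal_neg leI not_less_zero)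
  have L: "L \<noteq> top" and "ennreal (enn2real L powr (1 / 2)) < ennreal e"
    using e unfolding besicovitch_seminorm_def Limsup_mean_square[OF f] L_def[symmetric]
    by (auto simp: Let_def split: if_splits)
  then have "sqrt (enn2real L) < e"
    using e0 by (simp add: powr_half_sqrt ennreal_less_iff)
  then have "enn2real L < e\<^sup>2"
    using e0 real_sqrt_less_iff[of "enn2real L" "e\<^sup>2"] by (simp del: real_sqrt_less_iff)
  then have "L < ennreal (e\<^sup>2)"
    using L by (metis ennreal_enn2real ennreal_less_iff enn2real_nonneg top.not_eq_extremum)
  then have "eventually (\<lambda>l. ennreal (mean_square l f) < ennreal (e\<^sup>2)) at_top"
    unfolding L_def by (rule Limsup_lessD)
  then show ?thesis
    using eventually_gt_at_top[of 0]
    by eventually_elim (use e0 in \<open>auto simp: rms_less_iff ennreal_less_iff mean_square_nonneg\<close>)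
qed

lemma seminorm_le:
  assumes f: "loc_L2 f" and e: "e \<ge> 0" "eventually (\<lambda>l. rms l f \<le> e) at_top"
  shows "besicovitch_seminorm 2 f \<le> ennreal e"
proof -
  define L where "L = Limsup at_top (\<lambda>l. ennreal (mean_square l f))"
  have L: "L \<le> ennreal (e\<^sup>2)"
    unfolding L_def using e(2) by (intro Limsup_bounded) 
      (auto elim!: eventually_mono simp: rms_le_iff e(1) intro!: ennreal_leI)
  then have "L \<noteq> top" by (auto simp: top_unique)
  moreover have "enn2real L \<le> e\<^sup>2" using L by (simp add: enn2real_leI)
  then have "sqrt (enn2real L) \<le> e" using e(1) by (simp add: real_le_lsqrt)
  ultimately show ?thesis
    unfolding besicovitch_seminorm_def Limsup_mean_square[OF f] L_def[symmetric]
    by (auto simp: Let_def powr_half_sqrt intro!: ennreal_leI)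
qed

section \<open>Approximation by trigonometric polynomials\<close>

text \<open>
  Indexing a trigonometric polynomial by its set of frequencies makes distinct terms orthogonal and
  makes the coefficient at a frequency well defined.
\<close>

definition exp_sum :: "real set \<Rightarrow> (real \<Rightarrow> complex) \<Rightarrow> real \<Rightarrow> complex" where
  "exp_sum F c = (\<lambda>t. \<Sum>\<mu>\<in>F. c \<mu> * cis (\<mu> * t))"

lemma loc_L2_exp_sum: "loc_L2 (exp_sum F c)"
  unfolding exp_sum_def by (intro loc_L2_sum loc_L2_cmult loc_L2_cis)

lemma trig_polys_eq: "trig_polys = {exp_sum F c |F c. finite F}"
proof (intro equalityI subsetI)
  fix P assume "P \<in> trig_polys"
  then obtain n :: nat and a \<mu> where P: "P = (\<lambda>t. \<Sum>j=1..n. a j * cis (\<mu> j * t))"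
    unfolding trig_polys_def by blast
  have "P = exp_sum (\<mu> ` {1..n}) (\<lambda>\<nu>. \<Sum>j\<in>{j\<in>{1..n}. \<mu> j = \<nu>}. a j)"
  proof
    fix t
    have "P t = (\<Sum>\<nu>\<in>\<mu> ` {1..n}. \<Sum>j\<in>{j\<in>{1..n}. \<mu> j = \<nu>}. a j * cis (\<mu> j * t))"
      unfolding P by (rule sum.image_gen) simp
    also have "\<dots> = (\<Sum>\<nu>\<in>\<mu> ` {1..n}. (\<Sum>j\<in>{j\<in>{1..n}. \<mu> j = \<nu>}. a j) * cis (\<nu> * t))"
      by (intro sum.cong refl) (simp add: sum_distrib_right)
    finally show "P t = exp_sum (\<mu> ` {1..n}) (\<lambda>\<nu>. \<Sum>j\<in>{j\<in>{1..n}. \<mu> j = \<nu>}. a j) t"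
      by (simp add: exp_sum_def)
  qed
  then show "P \<in> {exp_sum F c |F c. finite F}" by blast
next
  fix P assume "P \<in> {exp_sum F c |F c. finite F}"
  then obtain F c where P: "P = exp_sum F c" and "finite F" by blast
  from ex_bij_betw_nat_finite_1[OF \<open>finite F\<close>] obtain h where h: "bij_betw h {1..card F} F"
    by blast
  have "P = (\<lambda>t. \<Sum>j=1..card F. c (h j) * cis (h j * t))"
    unfolding P exp_sum_def by (intro ext sum.reindex_bij_betw[OF h, symmetric])
  then show "P \<in> trig_polys" unfolding trig_polys_def
    by (intro CollectI exI[of _ "card F"] exI[of _ "\<lambda>j. c (h j)"] exI[of _ h])
qed

text \<open>
  Padding with zero coefficients brings any two trigonometric polynomials to a common set of
  frequencies.
\<close>

lemma exp_sum_extend: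
  "finite F' \<Longrightarrow> F \<subseteq> F' \<Longrightarrow> exp_sum F c = exp_sum F' (\<lambda>\<mu>. if \<mu> \<in> F then c \<mu> else 0)"
  unfolding exp_sum_def by (intro ext sum.mono_neutral_cong_left) auto

lemma exp_sum_diff: "exp_sum F c t - exp_sum F d t = exp_sum F (\<lambda>\<mu>. c \<mu> - d \<mu>) t"
  by (simp add: exp_sum_def sum_subtractf algebra_simps)

lemma besicovitch_space_iff:
  "f \<in> besicovitch_space 2 \<longleftrightarrow> loc_L2 f \<and>
     (\<forall>e>0. \<exists>F c. finite F \<and> eventually (\<lambda>l. rms l (\<lambda>t. f t - exp_sum F c t) < e) at_top)"
  (is "?L \<longleftrightarrow> ?R")
proof
  assume L: ?L
  then have f: "loc_L2 f" by (simp add: besicovitch_space_def)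
  have "\<exists>F c. finite F \<and> eventually (\<lambda>l. rms l (\<lambda>t. f t - exp_sum F c t) < e) at_top"
    if "e > 0" for e
  proof -
    from L that obtain F c where "finite F"
      "besicovitch_seminorm 2 (\<lambda>t. f t - exp_sum F c t) < ennreal e"
      unfolding besicovitch_space_def trig_polys_eq by blast
    with eventually_rms_less[OF loc_L2_diff[OF f loc_L2_exp_sum]] show ?thesis by blast
  qed
  with f show ?R by blast
next
  assume R: ?R
  then have f: "loc_L2 f" by simp
  have "\<exists>P\<in>trig_polys. besicovitch_seminorm 2 (\<lambda>t. f t - P t) < ennreal e" if "e > 0" for e
  proof -
    from R that obtain F c where F: "finite F"
      and ev: "eventually (\<lambda>l. rms l (\<lambda>t. f t - exp_sum F c t) < e / 2) at_top"
      by (meson half_gt_zero)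
    have "besicovitch_seminorm 2 (\<lambda>t. f t - exp_sum F c t) \<le> ennreal (e / 2)"
      using that ev by (intro seminorm_le loc_L2_diff f loc_L2_exp_sum)
        (auto elim: eventually_mono)
    also have "\<dots> < ennreal e" using that by (simp add: ennreal_less_iff)
    finally show ?thesis using F unfolding trig_polys_eq by blast
  qed
  with f show ?L by (simp add: besicovitch_space_def)
qed

lemma besicovitch_space_loc_L2: "f \<in> besicovitch_space 2 \<Longrightarrow> loc_L2 f"
  by (simp add: besicovitch_space_iff)

lemma besicovitch_space_diff:
  assumes f: "f \<in> besicovitch_space 2" and g: "g \<in> besicovitch_space 2"
  shows "(\<lambda>t. f t - g t) \<in> besicovitch_space 2"
  unfolding besicovitch_space_iff
proof (intro conjI allI impI)
  note lf = besicovitch_space_loc_L2[OF f] and lg = besicovitch_space_loc_L2[OF g]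
  show "loc_L2 (\<lambda>t. f t - g t)" by (rule loc_L2_diff[OF lf lg])
  fix e :: real assume "e > 0"
  then have e: "e / 2 > 0" by simp
  from f e obtain F c where F: "finite F"
    and 1: "eventually (\<lambda>l. rms l (\<lambda>t. f t - exp_sum F c t) < e / 2) at_top"
    unfolding besicovitch_space_iff by meson
  from g e obtain F' c' where F': "finite F'"
    and 2: "eventually (\<lambda>l. rms l (\<lambda>t. g t - exp_sum F' c' t) < e / 2) at_top"
    unfolding besicovitch_space_iff by meson
  define d where "d = (\<lambda>\<mu>. if \<mu> \<in> F then c \<mu> else 0)"
  define d' where "d' = (\<lambda>\<mu>. if \<mu> \<in> F' then c' \<mu> else 0)"
  have d: "exp_sum F c = exp_sum (F \<union> F') d" "exp_sum F' c' = exp_sum (F \<union> F') d'"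
    unfolding d_def d'_def using F F' by (intro exp_sum_extend; blast)+
  have "eventually (\<lambda>l. rms l (\<lambda>t. f t - g t - exp_sum (F \<union> F') (\<lambda>\<mu>. d \<mu> - d' \<mu>) t) < e) at_top"
    using 1 2 eventually_gt_at_top[of 0]
  proof eventually_elim
    case (elim l)
    have "rms l (\<lambda>t. f t - g t - exp_sum (F \<union> F') (\<lambda>\<mu>. d \<mu> - d' \<mu>) t)
      = rms l (\<lambda>t. (f t - exp_sum F c t) + (exp_sum F' c' t - g t))"
      by (simp add: d algebra_simps flip: exp_sum_diff)
    also have "\<dots> \<le> rms l (\<lambda>t. f t - exp_sum F c t) + rms l (\<lambda>t. exp_sum F' c' t - g t)"
      using elim by (intro rms_triangle loc_L2_diff lf lg loc_L2_exp_sum)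
    also have "\<dots> < e" using elim by (simp add: rms_diff_commute[of l "exp_sum F' c'"])
    finally show ?case .
  qed
  with F F' show "\<exists>F c. finite F \<and> eventually (\<lambda>l. rms l (\<lambda>t. f t - g t - exp_sum F c t) < e) at_top"
    by (intro exI[of _ "F \<union> F'"]) auto
qed

section \<open>Existence and continuity of Fourier coefficients\<close>

lemma interval_mean_sum:
  assumes "\<And>i. i \<in> A \<Longrightarrow> set_integrable lebesgue {-l..l} (f i)"
  shows "interval_mean l (\<lambda>t. \<Sum>i\<in>A. f i t) = (\<Sum>i\<in>A. interval_mean l (f i))"
  using assms unfolding interval_mean_def set_lebesgue_integral_def set_integrable_def
  by (simp add: scaleR_sum_right sum_divide_distrib Bochner_Integration.integral_sum)

lemma interval_mean_diff:
  assumes "set_integrable lebesgue {-l..l} f" "set_integrable lebesgue {-l..l} g"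
  shows "interval_mean l (\<lambda>t. f t - g t) = interval_mean l f - interval_mean l g"
  using assms unfolding interval_mean_def by (simp add: diff_divide_distrib)

lemma interval_mean_cmult: "interval_mean l (\<lambda>t. c * f t) = c * interval_mean l f"
  unfolding interval_mean_def by simp

lemma loc_L2_times_cis_integrable:
  "loc_L2 f \<Longrightarrow> set_integrable lebesgue {a..b} (\<lambda>t. f t * cis (- \<mu> * t))"
  using loc_L2_product_integrable[OF _ loc_L2_cis, of f a b \<mu>] by (simp add: cis_cnj)

text \<open>
  The Cauchy-Schwarz inequality against a function of modulus one, obtained by integrating
  \<open>2 A |f| \<le> |f|\<^sup>2 + A\<^sup>2\<close>, where \<open>A\<close> is slightly larger than the root mean square of \<open>f\<close>. It makes Fourier
  coefficients continuous for the seminorm.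
\<close>

lemma norm_interval_mean_le_rms:
  assumes f: "loc_L2 f" and l: "l > 0"
  shows "norm (interval_mean l (\<lambda>t. f t * cis (- \<mu> * t))) \<le> rms l f"
proof (rule field_le_epsilon)
  fix e :: real assume e: "e > 0"
  \<comment> \<open>the shift by e allows division by A when the root mean square vanishes\<close>
  define A where "A = rms l f + e"
  have A: "A > 0" using e mean_square_nonneg[OF l, of f] by (simp add: A_def rms_def add_nonneg_pos)
  have ms: "mean_square l f \<le> A\<^sup>2" using A e by (simp add: A_def flip: rms_le_iff)
  have "norm (interval_mean l (\<lambda>t. f t * cis (- \<mu> * t)))
      \<le> set_lebesgue_integral lebesgue {-l..l} (\<lambda>t. norm (f t * cis (- \<mu> * t))) / (2 * l)"
    unfolding interval_mean_def using l loc_L2_times_cis_integrable[OF f]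
    by (auto simp: norm_divide norm_mult intro!: divide_right_mono set_integral_norm_bound[THEN order_trans])
  also have "\<dots> \<le> set_lebesgue_integral lebesgue {-l..l} (\<lambda>t. 1 / (2 * A) * (norm (f t))\<^sup>2 + A / 2) / (2 * l)"
  proof (intro divide_right_mono set_integral_mono)
    show "set_integrable lebesgue {-l..l} (\<lambda>t. norm (f t * cis (- \<mu> * t)))"
      using loc_L2_times_cis_integrable[OF f] by (rule set_integrable_norm)
    show "set_integrable lebesgue {-l..l} (\<lambda>t. 1 / (2 * A) * (norm (f t))\<^sup>2 + A / 2)"
      by (intro set_integral_add set_integrable_mult_right loc_L2_square_integrable f
         absolutely_integrable_continuous_real continuous_intros)
    fix t
    have "2 * norm (f t) * A \<le> (norm (f t))\<^sup>2 + A\<^sup>2" by (rule sum_squares_bound)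
    then show "norm (f t * cis (- \<mu> * t)) \<le> 1 / (2 * A) * (norm (f t))\<^sup>2 + A / 2"
      using A by (simp add: norm_mult field_simps power2_eq_square)
  qed (use l in auto)
  also have "\<dots> = 1 / (2 * A) * mean_square l f + A / 2"
  proof -
    have "set_lebesgue_integral lebesgue {-l..l} (\<lambda>t. A / 2) = A / 2 * (2 * l)"
      using l by (subst set_integral_const) auto
    moreover have "set_lebesgue_integral lebesgue {-l..l} (\<lambda>t. 1 / (2 * A) * (norm (f t))\<^sup>2 + A / 2)
        = 1 / (2 * A) * set_lebesgue_integral lebesgue {-l..l} (\<lambda>t. (norm (f t))\<^sup>2)
          + set_lebesgue_integral lebesgue {-l..l} (\<lambda>t. A / 2)"
      by (subst set_integral_add(2)[OF set_integrable_mult_right[OF loc_L2_square_integrable[OF f]]])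
         (simp_all only: set_integral_mult_right absolutely_integrable_continuous_real
           continuous_on_const)
    ultimately show ?thesis unfolding mean_square_def using l A
      by (simp add: add_divide_distrib)
  qed
  also have "\<dots> \<le> 1 / (2 * A) * A\<^sup>2 + A / 2"
    using ms A by (intro add_right_mono mult_left_mono) auto
  also have "\<dots> = A" using A by (simp add: power2_eq_square)
  finally show "norm (interval_mean l (\<lambda>t. f t * cis (- \<mu> * t))) \<le> rms l f + e"
    by (simp add: A_def)
qed

text \<open>
  Orthonormality of the characters in the mean: the integral of a nonconstant character over
  \<open>[-l, l]\<close> stays bounded, so dividing by \<open>2 l\<close> sends it to zero.
\<close>

lemma interval_mean_cis_tendsto:
  "((\<lambda>l. interval_mean l (\<lambda>t. cis (\<mu> * t))) \<longlongrightarrow> (if \<mu> = 0 then 1 else 0)) at_top"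
proof (cases "\<mu> = 0")
  case True
  have "eventually (\<lambda>l. 1 = interval_mean l (\<lambda>t. cis (\<mu> * t))) at_top"
    using eventually_gt_at_top[of 0]
    by eventually_elim (simp add: True interval_mean_def set_integral_const scaleR_conv_of_real)
  then show ?thesis using True by (auto intro: Lim_transform_eventually)
next
  case False
  have "norm (interval_mean l (\<lambda>t. cis (\<mu> * t))) \<le> 1 / (\<bar>\<mu>\<bar> * l)" if l: "l > 0" for l
  proof -
    have "((\<lambda>t. cis (\<mu> * t)) has_integral
        cis (\<mu> * l) / (\<i> * \<mu>) - cis (\<mu> * (- l)) / (\<i> * \<mu>)) {-l..l}"
    proof (rule fundamental_theorem_of_calculus)
      fix x
      have "((\<lambda>z. exp (\<i> * (\<mu> * z)) / (\<i> * \<mu>)) has_field_derivative exp (\<i> * (\<mu> * x)))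
          (at (complex_of_real x))"
        using False by (auto intro!: derivative_eq_intros simp: field_simps)
      from has_vector_derivative_real_field[OF this]
      show "((\<lambda>t. cis (\<mu> * t) / (\<i> * \<mu>)) has_vector_derivative cis (\<mu> * x)) (at x within {-l..l})"
        by (simp add: cis_conv_exp)
    qed (use l in simp)
    moreover have "set_integrable lebesgue {-l..l} (\<lambda>t. cis (\<mu> * t))"
      by (intro absolutely_integrable_continuous_real continuous_intros)
    ultimately have "set_lebesgue_integral lebesgue {-l..l} (\<lambda>t. cis (\<mu> * t)) =
        cis (\<mu> * l) / (\<i> * \<mu>) - cis (\<mu> * (- l)) / (\<i> * \<mu>)"
      by (simp add: set_lebesgue_integral_eq_integral integral_unique)
    also have "norm \<dots> \<le> 2 / \<bar>\<mu>\<bar>"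
      by (rule order_trans[OF norm_triangle_ineq4]) (simp add: norm_divide norm_mult)
    finally show ?thesis
      using l False by (simp add: interval_mean_def norm_divide field_simps)
  qed
  then have "eventually (\<lambda>l. norm (interval_mean l (\<lambda>t. cis (\<mu> * t))) \<le> 1 / (\<bar>\<mu>\<bar> * l)) at_top"
    by (rule eventually_mono[OF eventually_gt_at_top[of 0]])
  moreover have "((\<lambda>l. 1 / (\<bar>\<mu>\<bar> * l)) \<longlongrightarrow> 0) at_top" using False by real_asymp
  ultimately show ?thesis using False by (auto intro: Lim_null_comparison)
qed

lemma interval_mean_exp_sum_tendsto:
  assumes F: "finite F"
  shows "((\<lambda>l. interval_mean l (\<lambda>t. exp_sum F c t * cis (- \<mu> * t)))
    \<longlongrightarrow> (if \<mu> \<in> F then c \<mu> else 0)) at_top"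
proof -
  have "interval_mean l (\<lambda>t. exp_sum F c t * cis (- \<mu> * t))
      = (\<Sum>\<nu>\<in>F. c \<nu> * interval_mean l (\<lambda>t. cis ((\<nu> - \<mu>) * t)))" for l
  proof -
    have "exp_sum F c t * cis (- \<mu> * t) = (\<Sum>\<nu>\<in>F. c \<nu> * cis ((\<nu> - \<mu>) * t))" for t
      unfolding exp_sum_def sum_distrib_right
      by (intro sum.cong refl) (simp add: mult.assoc cis_mult algebra_simps)
    then show ?thesis
      by (simp add: interval_mean_cmult interval_mean_sum absolutely_integrable_continuous_real continuous_intros)
  qed
  moreover have "((\<lambda>l. \<Sum>\<nu>\<in>F. c \<nu> * interval_mean l (\<lambda>t. cis ((\<nu> - \<mu>) * t)))
      \<longlongrightarrow> (\<Sum>\<nu>\<in>F. c \<nu> * (if \<nu> - \<mu> = 0 then 1 else 0))) at_top"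
    by (intro tendsto_sum tendsto_mult tendsto_const interval_mean_cis_tendsto)
  moreover have "(\<Sum>\<nu>\<in>F. c \<nu> * (if \<nu> - \<mu> = 0 then 1 else 0)) = (if \<mu> \<in> F then c \<mu> else 0)"
    using F by (simp add: if_distrib[of "\<lambda>x. _ * x"] sum.delta' cong: if_cong)
  ultimately show ?thesis by simp
qed

text \<open>
  The limits of better and better approximants form a Cauchy sequence, whose limit is the limit
  of \<open>u\<close>. Applied to interval means it transfers the existence of mean values from trigonometric
  polynomials to their closure.
\<close>

lemma tendsto_if_approximable:
  fixes u :: "'a \<Rightarrow> complex"
  assumes "A \<noteq> bot"
    and approx: "\<And>e. e > 0 \<Longrightarrow> \<exists>L. eventually (\<lambda>x. dist (u x) L < e) A"
  shows "\<exists>L. (u \<longlongrightarrow> L) A"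
proof -
  have "\<forall>k. \<exists>L. eventually (\<lambda>x. dist (u x) L < 1 / real (Suc k)) A"
    using approx by simp
  then obtain L where L: "\<And>k. eventually (\<lambda>x. dist (u x) (L k) < 1 / real (Suc k)) A"
    by metis
  have close: "dist (L m) (L n) < 1 / real (Suc m) + 1 / real (Suc n)" for m n
  proof -
    have "eventually (\<lambda>x. dist (L m) (L n) < 1 / real (Suc m) + 1 / real (Suc n)) A"
      using L[of m] L[of n] by eventually_elim
        (smt (verit) dist_triangle2 dist_commute)
    then show ?thesis using \<open>A \<noteq> bot\<close> by (simp add: eventually_const_iff)
  qed
  have small: "eventually (\<lambda>k. 1 / real (Suc k) < e) sequentially" if "e > 0" for e :: real
    using that by real_asymp
  have "Cauchy L"
  proof (rule metric_CauchyI)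
    fix e :: real assume "e > 0"
    then obtain N where N: "\<And>k. k \<ge> N \<Longrightarrow> 1 / real (Suc k) < e / 2"
      using small[of "e / 2"] by (auto simp: eventually_sequentially)
    then show "\<exists>M. \<forall>m\<ge>M. \<forall>n\<ge>M. dist (L m) (L n) < e"
      using close by (intro exI[of _ N]) (smt (verit) field_sum_of_halves)
  qed
  then obtain l where l: "L \<longlonglongrightarrow> l" using Cauchy_convergent_iff convergent_def by blast
  have "(u \<longlongrightarrow> l) A"
  proof (rule tendstoI)
    fix e :: real assume e: "e > 0"
    then have "eventually (\<lambda>k. dist (L k) l < e / 2 \<and> 1 / real (Suc k) < e / 2) sequentially"
      using l small[of "e / 2"] by (intro eventually_conj tendstoD) auto
    then obtain k where k: "dist (L k) l < e / 2" "1 / real (Suc k) < e / 2"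
      using eventually_happens by force
    show "eventually (\<lambda>x. dist (u x) l < e) A"
      using L[of k] by eventually_elim (use k dist_triangle[of _ l "L k"] in \<open>smt (verit) field_sum_of_halves\<close>)
  qed
  then show ?thesis ..
qed

lemma interval_mean_times_cis_diff:
  assumes "loc_L2 f" "loc_L2 g"
  shows "interval_mean l (\<lambda>t. f t * cis (- \<mu> * t)) - interval_mean l (\<lambda>t. g t * cis (- \<mu> * t))
    = interval_mean l (\<lambda>t. (f t - g t) * cis (- \<mu> * t))"
  using interval_mean_diff[OF loc_L2_times_cis_integrable[OF assms(1)]
      loc_L2_times_cis_integrable[OF assms(2)], of l \<mu> \<mu>]
  by (simp add: algebra_simps)

text \<open>
  A mean value is the unique limit only where a limit exists; this lemma provides it, and everything
  below uses Fourier coefficients through it.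
\<close>

lemma fourier_coeff_tendsto:
  assumes f: "f \<in> besicovitch_space 2"
  shows "((\<lambda>l. interval_mean l (\<lambda>t. f t * cis (- \<mu> * t))) \<longlongrightarrow> fourier_coeff f \<mu>) at_top"
proof -
  note lf = besicovitch_space_loc_L2[OF f]
  let ?m = "\<lambda>f l. interval_mean l (\<lambda>t. f t * cis (- \<mu> * t))"
  have "\<exists>L. (?m f \<longlongrightarrow> L) at_top"
  proof (rule tendsto_if_approximable)
    fix e :: real assume "e > 0"
    then have e: "e / 2 > 0" by simp
    from f e obtain F c where F: "finite F"
      and ev: "eventually (\<lambda>l. rms l (\<lambda>t. f t - exp_sum F c t) < e / 2) at_top"
      unfolding besicovitch_space_iff by meson
    define L where "L = (if \<mu> \<in> F then c \<mu> else 0)"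
    have "eventually (\<lambda>l. dist (?m (exp_sum F c) l) L < e / 2) at_top"
      using tendstoD[OF interval_mean_exp_sum_tendsto[OF F] e] by (simp add: L_def)
    then have "eventually (\<lambda>l. dist (?m f l) L < e) at_top"
      using ev eventually_gt_at_top[of 0]
    proof eventually_elim
      case (elim l)
      have "dist (?m f l) (?m (exp_sum F c) l) \<le> rms l (\<lambda>t. f t - exp_sum F c t)"
        unfolding dist_norm interval_mean_times_cis_diff[OF lf loc_L2_exp_sum]
        using elim by (intro norm_interval_mean_le_rms loc_L2_diff lf loc_L2_exp_sum)
      with elim show ?case using dist_triangle[of "?m f l" L "?m (exp_sum F c) l"] by linarith
    qed
    then show "\<exists>L. eventually (\<lambda>l. dist (?m f l) L < e) at_top" ..
  qed simp
  then obtain L where L: "(?m f \<longlongrightarrow> L) at_top" ..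
  then have "fourier_coeff f \<mu> = L"
    unfolding fourier_coeff_def mean_value_def interval_mean_def by (intro tendsto_Lim) auto
  with L show ?thesis by simp
qed

lemma fourier_coeff_diff:
  assumes f: "f \<in> besicovitch_space 2" and g: "g \<in> besicovitch_space 2"
  shows "fourier_coeff (\<lambda>t. f t - g t) \<mu> = fourier_coeff f \<mu> - fourier_coeff g \<mu>"
proof (rule tendsto_unique[OF _ fourier_coeff_tendsto])
  show "((\<lambda>l. interval_mean l (\<lambda>t. (f t - g t) * cis (- \<mu> * t)))
      \<longlongrightarrow> fourier_coeff f \<mu> - fourier_coeff g \<mu>) at_top"
    using tendsto_diff[OF fourier_coeff_tendsto[OF f] fourier_coeff_tendsto[OF g], of \<mu> \<mu>]
    unfolding interval_mean_times_cis_diff[OF f[THEN besicovitch_space_loc_L2] g[THEN besicovitch_space_loc_L2]] .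
qed (simp_all add: besicovitch_space_diff f g)

lemma norm_fourier_coeff_le:
  assumes f: "f \<in> besicovitch_space 2" and ev: "eventually (\<lambda>l. rms l f \<le> e) at_top"
  shows "norm (fourier_coeff f \<mu>) \<le> e"
proof (rule tendsto_upperbound[OF tendsto_norm[OF fourier_coeff_tendsto[OF f]]])
  show "eventually (\<lambda>l. norm (interval_mean l (\<lambda>t. f t * cis (- \<mu> * t))) \<le> e) at_top"
    using ev eventually_gt_at_top[of 0]
    by eventually_elim
       (use norm_interval_mean_le_rms[OF besicovitch_space_loc_L2[OF f]] in \<open>blast intro: order_trans\<close>)
qed simp

section \<open>Parseval's identity\<close>

lemma interval_mean_times_cnj_exp_sum_tendsto:
  assumes h: "loc_L2 h"
    and lim: "\<And>\<mu>. \<mu> \<in> F \<Longrightarrow> ((\<lambda>l. interval_mean l (\<lambda>t. h t * cis (- \<mu> * t))) \<longlongrightarrow> A \<mu>) at_top"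
  shows "((\<lambda>l. interval_mean l (\<lambda>t. h t * cnj (exp_sum F c t))) \<longlongrightarrow> (\<Sum>\<mu>\<in>F. cnj (c \<mu>) * A \<mu>)) at_top"
proof -
  have "interval_mean l (\<lambda>t. h t * cnj (exp_sum F c t))
      = (\<Sum>\<mu>\<in>F. cnj (c \<mu>) * interval_mean l (\<lambda>t. h t * cis (- \<mu> * t)))" for l
  proof -
    have "h t * cnj (exp_sum F c t) = (\<Sum>\<mu>\<in>F. cnj (c \<mu>) * (h t * cis (- \<mu> * t)))" for t
      unfolding exp_sum_def cnj_sum sum_distrib_left
      by (intro sum.cong refl) (simp add: cis_cnj algebra_simps)
    then show ?thesis
      using loc_L2_times_cis_integrable[OF h]
      by (simp only: interval_mean_sum interval_mean_cmult set_integrable_mult_right)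
  qed
  then show ?thesis by (simp only:) (intro tendsto_sum tendsto_mult tendsto_const lim)
qed

lemma mean_square_add:
  assumes f: "loc_L2 f" and g: "loc_L2 g"
  shows "mean_square l (\<lambda>t. f t + g t)
    = mean_square l f + mean_square l g + 2 * Re (interval_mean l (\<lambda>t. f t * cnj (g t)))"
proof -
  let ?I = "set_lebesgue_integral lebesgue {-l..l}"
  note fg = loc_L2_product_integrable[OF f g, of "-l" l]
  have Re: "set_integrable lebesgue {-l..l} (\<lambda>t. Re (f t * cnj (g t)))"
    and Re_eq: "?I (\<lambda>t. Re (f t * cnj (g t))) = Re (?I (\<lambda>t. f t * cnj (g t)))"
    using integrable_Re[OF fg[unfolded set_integrable_def]] integral_Re[OF fg[unfolded set_integrable_def]]
    unfolding set_integrable_def set_lebesgue_integral_def by simp_all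
  have "(norm (f t + g t))\<^sup>2 = (norm (f t))\<^sup>2 + (norm (g t))\<^sup>2 + 2 * Re (f t * cnj (g t))" for t
    unfolding cmod_power2 by (simp add: power2_eq_square algebra_simps)
  then have "?I (\<lambda>t. (norm (f t + g t))\<^sup>2)
      = ?I (\<lambda>t. (norm (f t))\<^sup>2) + ?I (\<lambda>t. (norm (g t))\<^sup>2) + 2 * Re (?I (\<lambda>t. f t * cnj (g t)))"
    using f g Re by (simp only: set_integral_add loc_L2_square_integrable Re_eq
        set_integral_mult_right set_integrable_mult_right)
  then show ?thesis
    by (simp add: mean_square_def interval_mean_def add_divide_distrib Re_divide_of_real)
qed

lemma mean_square_conv_interval_mean:
  "mean_square l f = Re (interval_mean l (\<lambda>t. f t * cnj (f t)))"
proof -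
  have "(\<lambda>t. f t * cnj (f t)) = (\<lambda>t. complex_of_real ((norm (f t))\<^sup>2))"
    by (intro ext) (simp add: complex_norm_square del: of_real_power)
  then show ?thesis
    by (simp add: interval_mean_def mean_square_def set_integral_complex_of_real
        flip: of_real_divide of_real_mult of_real_power del: of_real_power)
qed

lemma mean_square_exp_sum_tendsto:
  assumes "finite F"
  shows "((\<lambda>l. mean_square l (exp_sum F c)) \<longlongrightarrow> (\<Sum>\<mu>\<in>F. (norm (c \<mu>))\<^sup>2)) at_top"
proof -
  have "((\<lambda>l. interval_mean l (\<lambda>t. exp_sum F c t * cnj (exp_sum F c t)))
      \<longlongrightarrow> (\<Sum>\<mu>\<in>F. cnj (c \<mu>) * c \<mu>)) at_top"
  proof (rule interval_mean_times_cnj_exp_sum_tendsto[OF loc_L2_exp_sum])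
    fix \<mu> assume "\<mu> \<in> F"
    then show "((\<lambda>l. interval_mean l (\<lambda>t. exp_sum F c t * cis (- \<mu> * t))) \<longlongrightarrow> c \<mu>) at_top"
      using interval_mean_exp_sum_tendsto[OF assms, of c \<mu>] by simp
  qed
  moreover have "(\<Sum>\<mu>\<in>F. cnj (c \<mu>) * c \<mu>) = of_real (\<Sum>\<mu>\<in>F. (norm (c \<mu>))\<^sup>2)"
    unfolding of_real_sum
    by (intro sum.cong refl) (simp add: complex_norm_square mult.commute del: of_real_power)
  ultimately show ?thesis
    unfolding mean_square_conv_interval_mean using tendsto_Re by fastforce
qed

text \<open>
  Pythagoras in the mean. The remainder after subtracting the partial Fourier sum over \<open>F\<close> is
  asymptotically orthogonal to every polynomial with frequencies in \<open>F\<close>; so, among these polynomials,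
  the partial Fourier sum approximates \<open>f\<close> best, and the excess of any other one is explicit.
\<close>

lemma mean_square_partial_sum_minimal:
  assumes f: "f \<in> besicovitch_space 2" and F: "finite F"
  shows "((\<lambda>l. mean_square l (\<lambda>t. f t - exp_sum F c t)
            - mean_square l (\<lambda>t. f t - exp_sum F (fourier_coeff f) t))
          \<longlongrightarrow> (\<Sum>\<mu>\<in>F. (norm (fourier_coeff f \<mu> - c \<mu>))\<^sup>2)) at_top"
proof -
  note lf = besicovitch_space_loc_L2[OF f]
  define D where "D = (\<lambda>t. f t - exp_sum F (fourier_coeff f) t)"
  define d where "d = (\<lambda>\<mu>. fourier_coeff f \<mu> - c \<mu>)"
  have lD: "loc_L2 D" unfolding D_def by (intro loc_L2_diff lf loc_L2_exp_sum)
  have "((\<lambda>l. interval_mean l (\<lambda>t. D t * cnj (exp_sum F d t)))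
      \<longlongrightarrow> (\<Sum>\<mu>\<in>F. cnj (d \<mu>) * 0)) at_top"
  proof (rule interval_mean_times_cnj_exp_sum_tendsto[OF lD])
    fix \<mu> assume "\<mu> \<in> F"
    with tendsto_diff[OF fourier_coeff_tendsto[OF f, of \<mu>]
        interval_mean_exp_sum_tendsto[OF F, of "fourier_coeff f" \<mu>]]
    show "((\<lambda>l. interval_mean l (\<lambda>t. D t * cis (- \<mu> * t))) \<longlongrightarrow> 0) at_top"
      unfolding interval_mean_times_cis_diff[OF lf loc_L2_exp_sum] D_def by simp
  qed
  from tendsto_add[OF mean_square_exp_sum_tendsto[OF F, of d]
      tendsto_mult[OF tendsto_const[of 2] tendsto_Re[OF this]]]
  have lim: "((\<lambda>l. mean_square l (exp_sum F d) + 2 * Re (interval_mean l (\<lambda>t. D t * cnj (exp_sum F d t))))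
      \<longlongrightarrow> (\<Sum>\<mu>\<in>F. (norm (d \<mu>))\<^sup>2)) at_top" by simp
  have eq: "(\<lambda>t. f t - exp_sum F c t) = (\<lambda>t. D t + exp_sum F d t)"
    by (simp add: D_def d_def flip: exp_sum_diff)
  have "mean_square l (\<lambda>t. f t - exp_sum F c t) - mean_square l D
    = mean_square l (exp_sum F d) + 2 * Re (interval_mean l (\<lambda>t. D t * cnj (exp_sum F d t)))" for l
    unfolding eq by (subst mean_square_add[OF lD loc_L2_exp_sum]) simp
  with lim show ?thesis by (simp add: D_def d_def)
qed

lemma mean_square_bounded:
  assumes f: "f \<in> besicovitch_space 2"
  shows "\<exists>M. eventually (\<lambda>l. mean_square l f \<le> M) at_top"
proof -
  note lf = besicovitch_space_loc_L2[OF f]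
  from f obtain F c where F: "finite F"
    and ev: "eventually (\<lambda>l. rms l (\<lambda>t. f t - exp_sum F c t) < 1) at_top"
    unfolding besicovitch_space_iff by (meson zero_less_one)
  define S where "S = sqrt (\<Sum>\<mu>\<in>F. (norm (c \<mu>))\<^sup>2)"
  have "((\<lambda>l. rms l (exp_sum F c)) \<longlongrightarrow> S) at_top"
    unfolding rms_def S_def by (intro tendsto_real_sqrt mean_square_exp_sum_tendsto F)
  then have "eventually (\<lambda>l. rms l (exp_sum F c) < S + 1) at_top"
    by (rule order_tendstoD) simp
  then have "eventually (\<lambda>l. mean_square l f \<le> (S + 2)\<^sup>2) at_top"
    using ev eventually_gt_at_top[of 0]
  proof eventually_elim
    case (elim l)
    have "rms l f \<le> rms l (\<lambda>t. f t - exp_sum F c t) + rms l (exp_sum F c)"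
      using rms_triangle[OF loc_L2_diff[OF lf loc_L2_exp_sum[of F c]] loc_L2_exp_sum[of F c], of l] elim by simp
    then have "rms l f \<le> S + 2" using elim by simp
    moreover have "S + 2 \<ge> 0" by (simp add: S_def sum_nonneg add_nonneg_nonneg)
    ultimately show ?case by (simp add: rms_le_iff)
  qed
  then show ?thesis ..
qed

text \<open>
  The case \<open>c = 0\<close> of \<open>mean_square_partial_sum_minimal\<close>, where the mean square of the remainder is discarded because it is
  nonnegative.
\<close>

lemma bessel_inequality:
  assumes f: "f \<in> besicovitch_space 2" and "finite F" and "\<delta> > 0"
  shows "eventually (\<lambda>l. (\<Sum>\<mu>\<in>F. (norm (fourier_coeff f \<mu>))\<^sup>2) \<le> mean_square l f + \<delta>) at_top"
proof -
  have "((\<lambda>l. mean_square l f - mean_square l (\<lambda>t. f t - exp_sum F (fourier_coeff f) t))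
      \<longlongrightarrow> (\<Sum>\<mu>\<in>F. (norm (fourier_coeff f \<mu>))\<^sup>2)) at_top"
    using mean_square_partial_sum_minimal[OF f \<open>finite F\<close>, of "\<lambda>_. 0"] by (simp add: exp_sum_def)
  then have "eventually (\<lambda>l. (\<Sum>\<mu>\<in>F. (norm (fourier_coeff f \<mu>))\<^sup>2) - \<delta>
      < mean_square l f - mean_square l (\<lambda>t. f t - exp_sum F (fourier_coeff f) t)) at_top"
    using \<open>\<delta> > 0\<close> by (intro order_tendstoD) auto
  then show ?thesis
    using eventually_gt_at_top[of 0]
    by eventually_elim (use mean_square_nonneg in \<open>smt (verit)\<close>)
qed

lemma fourier_coeff_square_summable:
  assumes f: "f \<in> besicovitch_space 2"
  shows "(\<lambda>\<mu>. (norm (fourier_coeff f \<mu>))\<^sup>2) summable_on UNIV"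
proof -
  obtain M where M: "eventually (\<lambda>l. mean_square l f \<le> M) at_top"
    using mean_square_bounded[OF f] ..
  have "(\<Sum>\<mu>\<in>F. (norm (fourier_coeff f \<mu>))\<^sup>2) \<le> M + 1" if "finite F" for F
  proof -
    have "eventually (\<lambda>l::real. (\<Sum>\<mu>\<in>F. (norm (fourier_coeff f \<mu>))\<^sup>2) \<le> M + 1) at_top"
      using M bessel_inequality[OF f that zero_less_one] by eventually_elim simp
    then show ?thesis by (simp add: eventually_const_iff)
  qed
  then show ?thesis
    by (intro nonneg_bdd_above_summable_on) (auto simp: bdd_above_def)
qed

text \<open>
  Bessel's inequality gives the lower bound. For the upper bound, some trigonometric polynomial is
  close to \<open>f\<close>; by minimality the partial Fourier sum over any larger set of frequencies is at least
  as close, and its mean square is at most the full sum of squared coefficients.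
\<close>

theorem parseval:
  assumes f: "f \<in> besicovitch_space 2"
  shows "((\<lambda>l. mean_square l f) \<longlongrightarrow> (\<Sum>\<^sub>\<infinity>\<mu>. (norm (fourier_coeff f \<mu>))\<^sup>2)) at_top"
proof (rule tendstoI)
  fix e :: real assume e: "e > 0"
  let ?a = "\<lambda>\<mu>. (norm (fourier_coeff f \<mu>))\<^sup>2"
  define s where "s = infsum ?a UNIV"
  note summable = fourier_coeff_square_summable[OF f]
  have le_s: "sum ?a F \<le> s" if "finite F" for F
    unfolding s_def using summable that by (intro finite_sum_le_infsum) auto
  have "(?a has_sum s) UNIV" unfolding s_def using summable by (rule has_sum_infsum)
  then have "eventually (\<lambda>F. dist (sum ?a F) s < e / 2) (finite_subsets_at_top UNIV)"
    unfolding has_sum_def using e by (intro tendstoD) auto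
  then obtain F1 where F1: "finite F1" "dist (sum ?a F1) s < e / 2"
    unfolding eventually_finite_subsets_at_top by blast
  have "sqrt (e / 4) > 0" using e by simp
  with f obtain F0 c where F0: "finite F0"
    and ev: "eventually (\<lambda>l. rms l (\<lambda>t. f t - exp_sum F0 c t) < sqrt (e / 4)) at_top"
    unfolding besicovitch_space_iff by meson
  \<comment> \<open>F0 makes the remainder small, F1 makes the partial sum of squares nearly full\<close>
  define F where "F = F0 \<union> F1"
  have F: "finite F" using F0 F1 by (simp add: F_def)
  define D where "D = (\<lambda>t. f t - exp_sum F (fourier_coeff f) t)"
  define d where "d = (\<lambda>\<mu>. if \<mu> \<in> F0 then c \<mu> else 0)"
  have P: "exp_sum F0 c = exp_sum F d"
    unfolding d_def using F by (intro exp_sum_extend) (auto simp: F_def)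
  have "eventually (\<lambda>l. - (e / 4) < mean_square l (\<lambda>t. f t - exp_sum F d t) - mean_square l D) at_top"
    unfolding D_def
  proof (rule order_tendstoD(1)[OF mean_square_partial_sum_minimal[OF f F]])
    have "0 \<le> (\<Sum>\<mu>\<in>F. (norm (fourier_coeff f \<mu> - d \<mu>))\<^sup>2)" by (intro sum_nonneg) simp
    then show "- (e / 4) < (\<Sum>\<mu>\<in>F. (norm (fourier_coeff f \<mu> - d \<mu>))\<^sup>2)" using e by linarith
  qed
  moreover have "((\<lambda>l. mean_square l f - mean_square l D) \<longlongrightarrow> sum ?a F) at_top"
    using mean_square_partial_sum_minimal[OF f F, of "\<lambda>_. 0"] by (simp add: exp_sum_def D_def)
  then have "eventually (\<lambda>l. mean_square l f - mean_square l D < sum ?a F + e / 2) at_top"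
    using e by (intro order_tendstoD) auto
  moreover have "eventually (\<lambda>l. sum ?a F1 \<le> mean_square l f + e / 4) at_top"
    using e F1 by (intro bessel_inequality f) auto
  ultimately show "eventually (\<lambda>l. dist (mean_square l f) s < e) at_top"
    using ev
  proof eventually_elim
    case (elim l)
    have "mean_square l (\<lambda>t. f t - exp_sum F d t) < e / 4"
      using elim(4) e unfolding P by (subst (asm) rms_less_iff) auto
    then have "mean_square l f < s + e" using elim le_s[OF F] by linarith
    moreover have "mean_square l f > s - e" using elim(3) F1(2) e unfolding dist_real_def by linarith
    ultimately show ?case by (simp add: dist_real_def abs_less_iff)
  qed
qed

section \<open>Completeness\<close>

lemma rms_sum_le:
  assumes "l > 0" "\<And>i. i \<in> A \<Longrightarrow> loc_L2 (f i)"
  shows "rms l (\<lambda>t. \<Sum>i\<in>A. f i t) \<le> (\<Sum>i\<in>A. rms l (f i))"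
  using assms(2)
proof (induction A rule: infinite_finite_induct)
  case (insert x F)
  then have "rms l (\<lambda>t. f x t + (\<Sum>i\<in>F. f i t)) \<le> rms l (f x) + rms l (\<lambda>t. \<Sum>i\<in>F. f i t)"
    using assms(1) by (intro rms_triangle loc_L2_sum) auto
  with insert show ?case by simp
qed (simp_all add: rms_def mean_square_def)

lemma loc_L2_restrict:
  assumes f: "loc_L2 f" and A: "A \<in> sets lebesgue"
  shows "loc_L2 (\<lambda>t. if t \<in> A then f t else 0)"
  unfolding loc_L2_iff
proof (intro conjI allI)
  show m: "(\<lambda>t. if t \<in> A then f t else 0) \<in> borel_measurable lebesgue"
    by (rule measurable_If_set) (auto intro: A loc_L2_measurable[OF f])
  fix a b
  show "set_integrable lebesgue {a..b} (\<lambda>t. (norm (if t \<in> A then f t else 0))\<^sup>2)"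
    by (rule set_integrable_dominated[OF loc_L2_square_integrable[OF f]])
       (use borel_measurable_power[OF measurable_compose[OF m borel_measurable_norm]] in auto)
qed

lemma rms_bounded_support_tendsto_0:
  assumes "\<And>t. T < \<bar>t\<bar> \<Longrightarrow> v t = 0"
  shows "((\<lambda>l. rms l v) \<longlongrightarrow> 0) at_top"
proof -
  define C where "C = set_lebesgue_integral lebesgue {-T..T} (\<lambda>t. (norm (v t))\<^sup>2)"
  have "eventually (\<lambda>l. sqrt (C / (2 * l)) = rms l v) at_top"
    using eventually_ge_at_top[of T]
  proof eventually_elim
    case (elim l)
    have "set_lebesgue_integral lebesgue {-l..l} (\<lambda>t. (norm (v t))\<^sup>2) = C"
      unfolding C_def set_lebesgue_integral_def using elim assms
      by (intro Bochner_Integration.integral_cong) (auto simp: indicator_def abs_le_iff not_le)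
    then show ?case by (simp add: rms_def mean_square_def)
  qed
  moreover have "((\<lambda>l. sqrt (C / (2 * l))) \<longlongrightarrow> sqrt 0) at_top"
    by (intro tendsto_real_sqrt) real_asymp
  ultimately show ?thesis by (auto intro: Lim_transform_eventually)
qed

text \<open>
  The gluing behind the completeness of the Besicovitch spaces. The increment \<open>h (Suc k) - h k\<close> has
  root mean square at most \<open>(1/2)\<^sup>k\<close> only over the intervals \<open>[-l, l]\<close> with \<open>l \<ge> T k\<close>, for some \<open>T k\<close>. Erasing it on the window
  \<open>|t| < T k\<close> does not change its seminorm, but makes the bound valid for every \<open>l > 0\<close>; the
  erased increments can then be summed uniformly in \<open>l\<close>. As \<open>T k \<ge> k\<close>, only finitely many of them are
  nonzero at a given point, so the sum converges trivially.
\<close>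

lemma fast_cauchy_has_limit:
  fixes h :: "nat \<Rightarrow> real \<Rightarrow> complex"
  assumes h: "\<And>k. loc_L2 (h k)"
    and fast: "\<And>k. eventually (\<lambda>l. rms l (\<lambda>t. h (Suc k) t - h k t) \<le> (1/2) ^ k) at_top"
  shows "\<exists>g. loc_L2 g \<and> (\<forall>n. eventually (\<lambda>l. rms l (\<lambda>t. g t - h n t) \<le> 3 * (1/2) ^ n) at_top)"
proof -
  define d where "d k t = h (Suc k) t - h k t" for k t
  have ld: "loc_L2 (d k)" for k unfolding d_def by (intro loc_L2_diff h)
  have "\<exists>T\<ge>real k. \<forall>l\<ge>T. rms l (d k) \<le> (1/2) ^ k" for k
    using fast[of k] unfolding d_def eventually_at_top_linorder by (meson max.cobounded1 max.cobounded2 order_trans)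
  then obtain T where T: "\<And>k. T k \<ge> real k" "\<And>k l. l \<ge> T k \<Longrightarrow> rms l (d k) \<le> (1/2) ^ k"
    by metis
  define u where "u k t = (if t \<in> {t. T k \<le> \<bar>t\<bar>} then d k t else 0)" for k t
  define v where "v k t = d k t - u k t" for k t
  have lu: "loc_L2 (u k)" for k
  proof -
    have "closed {t. T k \<le> \<bar>t\<bar>}" by (intro closed_Collect_le continuous_intros)
    then have "{t. T k \<le> \<bar>t\<bar>} \<in> sets lebesgue" using borel_closed sets_completionI_sets by fastforce
    then show ?thesis unfolding u_def by (intro loc_L2_restrict ld)
  qed
  have lv: "loc_L2 (v k)" for k unfolding v_def by (intro loc_L2_diff ld lu)
  have u_le: "rms l (u k) \<le> (1/2) ^ k" if l: "l > 0" for l k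
  proof (cases "T k \<le> l")
    case True
    have "rms l (u k) \<le> rms l (d k)"
      by (rule rms_mono[OF lu ld l]) (simp add: u_def)
    with T(2)[OF True] show ?thesis by simp
  next
    case False
    then have "rms l (u k) = rms l (\<lambda>_. 0)" by (intro rms_cong) (auto simp: u_def)
    also have "\<dots> = 0" by (simp add: rms_def mean_square_def)
    finally show ?thesis by simp
  qed
  define g where "g t = h 0 t + (\<Sum>k. u k t)" for t
  have g_eq: "g t = h 0 t + (\<Sum>k<m. u k t)" if "\<bar>t\<bar> < real m" for m t
  proof -
    have "u k t = 0" if "k \<notin> {..<m}" for k
      using that \<open>\<bar>t\<bar> < real m\<close> T(1)[of k] by (simp add: u_def)
    then show ?thesis unfolding g_def by (subst suminf_finite[of "{..<m}"]) auto
  qed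
  have lg: "loc_L2 g"
    unfolding loc_L2_iff
  proof (intro conjI allI)
    note [measurable] = loc_L2_measurable[OF lu] loc_L2_measurable[OF h]
    show "g \<in> borel_measurable lebesgue" unfolding g_def by measurable
    fix a b :: real
    obtain m :: nat where m: "max \<bar>a\<bar> \<bar>b\<bar> < real m" using reals_Archimedean2 by blast
    have "loc_L2 (\<lambda>t. h 0 t + (\<Sum>k<m. u k t))" by (intro loc_L2_add loc_L2_sum h lu)
    moreover have "g t = h 0 t + (\<Sum>k<m. u k t)" if "t \<in> {a..b}" for t
      using that m by (intro g_eq) auto
    ultimately show "set_integrable lebesgue {a..b} (\<lambda>t. (norm (g t))\<^sup>2)"
      using loc_L2_square_integrable[of _ a b] by (subst set_integrable_cong[OF refl refl]) auto
  qed
  have "eventually (\<lambda>l. rms l (\<lambda>t. g t - h n t) \<le> 3 * (1/2) ^ n) at_top" for n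
  proof -
    have "((\<lambda>l. rms l (\<lambda>t. \<Sum>k<n. v k t)) \<longlongrightarrow> 0) at_top"
    proof (rule rms_bounded_support_tendsto_0)
      fix t assume "Max (insert 0 (T ` {..<n})) < \<bar>t\<bar>"
      then show "(\<Sum>k<n. v k t) = 0" by (auto simp: v_def u_def less_imp_le)
    qed
    \<comment> \<open>the erased parts are finitely many functions of bounded support, hence null in the mean\<close>
    then have "eventually (\<lambda>l. rms l (\<lambda>t. \<Sum>k<n. v k t) < (1/2) ^ n) at_top"
      by (rule order_tendstoD) simp
    then show ?thesis using eventually_gt_at_top[of 0]
    proof eventually_elim
      case (elim l)
      obtain m0 :: nat where "l < real m0" using reals_Archimedean2 by blast
      define m where "m = n + m0"
      have m: "l < real m" "n \<le> m" using \<open>l < real m0\<close> by (auto simp: m_def)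
      have telescope: "h n t = h 0 t + (\<Sum>k<n. d k t)" for t
        by (induction n) (auto simp: d_def)
      have "g t - h n t = (\<Sum>k\<in>{n..<m}. u k t) - (\<Sum>k<n. v k t)" if "t \<in> {-l..l}" for t
      proof -
        have "g t = h 0 t + (\<Sum>k<m. u k t)" using that m by (intro g_eq) auto
        moreover have "(\<Sum>k<m. u k t) = (\<Sum>k<n. u k t) + (\<Sum>k\<in>{n..<m}. u k t)"
          using m(2) by (metis atLeast0LessThan sum.atLeastLessThan_concat zero_le)
        ultimately show ?thesis by (simp add: telescope v_def sum_subtractf)
      qed
      then have "rms l (\<lambda>t. g t - h n t) = rms l (\<lambda>t. (\<Sum>k\<in>{n..<m}. u k t) - (\<Sum>k<n. v k t))"
        by (intro rms_cong) simp
      also have "\<dots> \<le> rms l (\<lambda>t. \<Sum>k\<in>{n..<m}. u k t) + rms l (\<lambda>t. - (\<Sum>k<n. v k t))"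
        using rms_triangle[of "\<lambda>t. \<Sum>k\<in>{n..<m}. u k t" "\<lambda>t. - (\<Sum>k<n. v k t)" l] elim
          loc_L2_cmult[of "\<lambda>t. \<Sum>k<n. v k t" "- 1"]
        by (simp add: loc_L2_sum lu lv)
      also have "rms l (\<lambda>t. - (\<Sum>k<n. v k t)) = rms l (\<lambda>t. \<Sum>k<n. v k t)"
        by (intro rms_cong) simp
      also have "rms l (\<lambda>t. \<Sum>k\<in>{n..<m}. u k t) \<le> (\<Sum>k\<in>{n..<m}. (1/2) ^ k)"
        using elim by (intro order_trans[OF rms_sum_le] sum_mono u_le lu)
      also have "(\<Sum>k\<in>{n..<m}. (1/2) ^ k) \<le> (2 * (1/2) ^ n :: real)"
      proof -
        have "(\<Sum>k\<in>{n..<m}. (1/2) ^ k) = (2 * (1/2) ^ n - 2 * (1/2) ^ m :: real)"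
          using m(2) by (induction m rule: dec_induct) auto
        then show ?thesis by simp
      qed
      finally show ?case using elim by simp
    qed
  qed
  with lg show ?thesis by blast
qed

text \<open>
  Members of the sequence that approach each other fast have a limit by the gluing lemma, and the Cauchy condition extends
  the convergence to the whole sequence. The limit is approximable by trigonometric polynomials
  because the members of the sequence are.
\<close>

theorem besicovitch_space_complete:
  fixes s :: "nat \<Rightarrow> real \<Rightarrow> complex"
  assumes s: "\<And>k. s k \<in> besicovitch_space 2"
    and Cauchy: "\<And>e. e > 0 \<Longrightarrow>
      \<exists>N. \<forall>m\<ge>N. \<forall>n\<ge>N. eventually (\<lambda>l. rms l (\<lambda>t. s m t - s n t) \<le> e) at_top"
  obtains g where "g \<in> besicovitch_space 2"
    and "\<And>e. e > 0 \<Longrightarrow> \<exists>N. \<forall>n\<ge>N. eventually (\<lambda>l. rms l (\<lambda>t. s n t - g t) \<le> e) at_top"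
proof -
  note ls = besicovitch_space_loc_L2[OF s]
  have "\<forall>k. \<exists>N. \<forall>m\<ge>N. \<forall>n\<ge>N. eventually (\<lambda>l. rms l (\<lambda>t. s m t - s n t) \<le> (1/2) ^ k) at_top"
    using Cauchy by simp
  then obtain N where N: "\<And>k m n. m \<ge> N k \<Longrightarrow> n \<ge> N k \<Longrightarrow>
      eventually (\<lambda>l. rms l (\<lambda>t. s m t - s n t) \<le> (1/2) ^ k) at_top"
    by metis
  \<comment> \<open>summing the thresholds makes R monotone, so R k and R (Suc k) are both at least N k\<close>
  define R where "R k = (\<Sum>i\<le>k. N i)" for k
  have R: "N k \<le> R k" "N k \<le> R (Suc k)" for k
    by (auto simp: R_def intro: member_le_sum trans_le_add1)
  obtain g where lg: "loc_L2 g"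
    and g: "\<And>n. eventually (\<lambda>l. rms l (\<lambda>t. g t - s (R n) t) \<le> 3 * (1/2) ^ n) at_top"
    using fast_cauchy_has_limit[of "\<lambda>k. s (R k)"] ls N R by blast
  have limit: "\<exists>M. \<forall>n\<ge>M. eventually (\<lambda>l. rms l (\<lambda>t. s n t - g t) \<le> e) at_top" if "e > 0" for e
  proof -
    obtain k where k: "(1/2) ^ k < e / 4"
      using real_arch_pow_inv[of "e / 4" "1/2"] \<open>e > 0\<close> by fastforce
    have "eventually (\<lambda>l. rms l (\<lambda>t. s n t - g t) \<le> e) at_top" if "n \<ge> N k" for n
      using N[OF that R(1)] g[of k] eventually_gt_at_top[of 0]
    proof eventually_elim
      case (elim l)
      have "rms l (\<lambda>t. s n t - g t) \<le> rms l (\<lambda>t. s n t - s (R k) t) + rms l (\<lambda>t. s (R k) t - g t)"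
        using elim by (intro rms_triangle_diff ls lg)
      then show ?case using elim k by (simp add: rms_diff_commute[of l "s (R k)"])
    qed
    then show ?thesis by blast
  qed
  have "g \<in> besicovitch_space 2"
    unfolding besicovitch_space_iff
  proof (intro conjI allI impI lg)
    fix e :: real assume "e > 0"
    then have e: "e / 2 > 0" by simp
    from limit[OF e] obtain n where n: "eventually (\<lambda>l. rms l (\<lambda>t. s n t - g t) \<le> e / 2) at_top"
      by blast
    from s[of n] e obtain F c where F: "finite F"
      and P: "eventually (\<lambda>l. rms l (\<lambda>t. s n t - exp_sum F c t) < e / 2) at_top"
      unfolding besicovitch_space_iff by meson
    from n P have "eventually (\<lambda>l. rms l (\<lambda>t. g t - exp_sum F c t) < e) at_top"
      using eventually_gt_at_top[of 0]
    proof eventually_elim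
      case (elim l)
      have "rms l (\<lambda>t. g t - exp_sum F c t) \<le> rms l (\<lambda>t. g t - s n t) + rms l (\<lambda>t. s n t - exp_sum F c t)"
        using elim by (intro rms_triangle_diff ls lg loc_L2_exp_sum)
      then show ?case using elim by (simp add: rms_diff_commute[of l g])
    qed
    with F show "\<exists>F c. finite F \<and> eventually (\<lambda>l. rms l (\<lambda>t. g t - exp_sum F c t) < e) at_top"
      by blast
  qed
  with limit that show ?thesis by blast
qed

section \<open>Compactness of rational characters\<close>

interpretation rat: vector_space rat_scale
  by (rule vector_space_rat_scale)

lemma rat_linear_on_sum:
  assumes \<psi>: "rat_linear_on (rat_span S) \<psi>" and "B \<subseteq> rat_span S"
  shows "\<psi> (\<Sum>v\<in>B. rat_scale (q v) v) = (\<Sum>v\<in>B. of_rat (q v) * \<psi> v)"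
  using assms(2)
proof (induction B rule: infinite_finite_induct)
  case (insert x F)
  then have "rat_scale (q x) x \<in> rat_span S" "(\<Sum>v\<in>F. rat_scale (q v) v) \<in> rat_span S"
    unfolding rat_span_def by (auto intro!: rat.span_scale rat.span_sum)
  with insert \<psi> show ?case by (simp add: rat_linear_on_def) (simp add: rat_scale_def)
next
  have "\<psi> (rat_scale 0 0) = rat_scale 0 (\<psi> 0)"
    using \<psi> by (simp add: rat_linear_on_def rat_span_def rat.span_zero del: rat.scale_zero_left rat.scale_zero_right)
  then have zero: "\<psi> 0 = 0" by simp
  { case (infinite A) show ?case using infinite.hyps zero by simp
  next case empty show ?case using zero by simp }
qed

lemma common_denominator:
  assumes "finite (A :: rat set)"
  shows "\<exists>D::int. D > 0 \<and> (\<forall>q\<in>A. q * of_int D \<in> \<int>)"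
  using assms
proof induction
  case empty
  show ?case by (intro exI[of _ 1]) simp
next
  case (insert q A)
  then obtain D where D: "D > 0" "\<forall>q\<in>A. q * of_int D \<in> \<int>" by blast
  obtain a b where q: "q = Fract a b" "b > 0" "coprime a b" by (rule Rat_cases)
  have "q * of_int (D * b) = of_int (a * D)"
    using q by (simp add: Fract_of_int_quotient)
  then have "q * of_int (D * b) \<in> \<int>" by (metis Ints_of_int)
  moreover have "p * of_int (D * b) \<in> \<int>" if "p \<in> A" for p
    using Ints_mult[OF D(2)[rule_format, OF that] Ints_of_int[of b]] by (simp add: mult.assoc)
  ultimately show ?case
    using D(1) q(2) by (intro exI[of _ "D * b"]) auto
qed

text \<open>
  For a finite \<open>X\<close> the tuples \<open>(cis (\<psi> x))\<close>, with \<open>\<psi>\<close> ranging over the rational linear maps on the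
  span of \<open>X\<close>, form a compact set: after clearing denominators each \<open>\<psi> x\<close> is an integer combination of the
  values of \<open>\<psi>\<close> at the vectors \<open>v / D\<close>, where \<open>v\<close> runs through a basis. Only the residues of these values
  modulo \<open>2 \<pi>\<close> affect the tuple, so the set is a continuous image of a torus. The maps \<open>\<psi> k\<close>
  themselves need not have a convergent subsequence, as their values may be unbounded.
\<close>

lemma rational_characters_seq_compact:
  assumes X: "finite X" and \<psi>: "\<And>k::nat. rat_linear_on (rat_span X) (\<psi> k)"
  obtains r \<phi> where "strict_mono r" "rat_linear_on (rat_span X) \<phi>"
    and "\<And>x. x \<in> X \<Longrightarrow> (\<lambda>k. cis (\<psi> (r k) x)) \<longlonglongrightarrow> cis (\<phi> x)"
proof -
  obtain B where B: "B \<subseteq> X" "rat.independent B" "X \<subseteq> rat.span B"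
    using rat.maximal_independent_subset by blast
  have finB: "finite B" using B(1) X finite_subset by blast
  have span: "rat_span X = rat.span B"
    unfolding rat_span_def using B by (metis rat.span_mono rat.span_span subset_antisym)
  define q where "q = rat.representation B"
  obtain D :: int where D: "D > 0"
    and "\<forall>p\<in>(\<lambda>(x, v). q x v) ` (X \<times> B). p * of_int D \<in> \<int>"
    using common_denominator[of "(\<lambda>(x, v). q x v) ` (X \<times> B)"] X finB by blast
  then have "\<forall>x\<in>X. \<forall>v\<in>B. \<exists>z::int. q x v * of_int D = of_int z"
    by (auto simp: Ints_def)
  then obtain z :: "real \<Rightarrow> real \<Rightarrow> int"
    where z: "\<And>x v. x \<in> X \<Longrightarrow> v \<in> B \<Longrightarrow> q x v * of_int D = of_int (z x v)"
    by metis
  have z': "of_rat (q x v) * real_of_int D = real_of_int (z x v)" if "x \<in> X" "v \<in> B" for x v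
    using arg_cong[OF z[OF that], of "of_rat :: rat \<Rightarrow> real"] by (simp add: of_rat_mult)
  \<comment> \<open>w measures the value of \<psi> k at v / D in full turns; its fractional part gives the angle \<theta>\<close>
  define w where "w k v = \<psi> k v / (2 * pi * of_int D)" for k v
  define \<theta> where "\<theta> k v = 2 * pi * frac (w k v)" for k v
  have "norm (\<theta> k v) \<le> 2 * pi" for k v
    using frac_lt_1[of "w k v"] frac_ge_0[of "w k v"] by (simp add: \<theta>_def abs_mult)
  then obtain r where r: "strict_mono r"
    and "\<And>v. v \<in> B \<Longrightarrow> \<exists>l. (\<lambda>k. \<theta> (r k) v) \<longlonglongrightarrow> l"
    using function_convergent_subsequence[of B \<theta> "2 * pi"] finB by (metis countable_finite)
  then obtain \<theta>' where \<theta>': "\<And>v. v \<in> B \<Longrightarrow> (\<lambda>k. \<theta> (r k) v) \<longlonglongrightarrow> \<theta>' v"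
    by metis
  define \<phi> where "\<phi> x = (\<Sum>v\<in>B. of_rat (q x v) * (of_int D * \<theta>' v))" for x
  show thesis
  proof (rule that[OF r])
    show "rat_linear_on (rat_span X) \<phi>"
      unfolding rat_linear_on_def span
      by (auto simp: \<phi>_def q_def rat.representation_add rat.representation_scale B(2) of_rat_add of_rat_mult
          distrib_right sum.distrib rat_scale_def[of _ "sum _ _"] sum_distrib_left mult.assoc)
    fix x assume x: "x \<in> X"
    have "\<phi> x = (\<Sum>v\<in>B. of_int (z x v) * \<theta>' v)"
      unfolding \<phi>_def by (intro sum.cong refl) (simp add: z'[OF x, symmetric])
    moreover have "cis (\<psi> k x) = cis (\<Sum>v\<in>B. of_int (z x v) * \<theta> k v)" for k
    proof -
      have "x = (\<Sum>v\<in>B. rat_scale (q x v) v)"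
        unfolding q_def using x B finB by (subst rat.sum_representation_eq) auto
      then have "\<psi> k x = (\<Sum>v\<in>B. of_rat (q x v) * \<psi> k v)"
        using rat_linear_on_sum[OF \<psi>, of B k "q x"] B by (metis rat.span_superset span)
      also have "\<dots> = (\<Sum>v\<in>B. of_int (z x v) * \<theta> k v + 2 * pi * of_int (z x v * \<lfloor>w k v\<rfloor>))"
      proof (intro sum.cong refl)
        fix v assume v: "v \<in> B"
        have "\<psi> k v = of_int D * (2 * pi * w k v)" using D by (simp add: w_def)
        then have "of_rat (q x v) * \<psi> k v = of_int (z x v) * (2 * pi * w k v)"
          using z'[OF x v] by (simp add: mult.assoc[symmetric])
        then show "of_rat (q x v) * \<psi> k v
            = of_int (z x v) * \<theta> k v + 2 * pi * of_int (z x v * \<lfloor>w k v\<rfloor>)"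
          by (simp add: \<theta>_def frac_def algebra_simps)
      qed
      also have "\<dots> = (\<Sum>v\<in>B. of_int (z x v) * \<theta> k v) + 2 * pi * of_int (\<Sum>v\<in>B. z x v * \<lfloor>w k v\<rfloor>)"
        by (simp add: sum.distrib sum_distrib_left)
      finally have "cis (\<psi> k x) = cis (\<Sum>v\<in>B. of_int (z x v) * \<theta> k v)
          * cis (2 * pi * of_int (\<Sum>v\<in>B. z x v * \<lfloor>w k v\<rfloor>))"
        by (simp only: cis_mult)
      then show ?thesis by (simp only: cis_multiple_2pi Ints_of_int mult_1_right)
    qed
    moreover have "(\<lambda>k. cis (\<Sum>v\<in>B. of_int (z x v) * \<theta> (r k) v))
        \<longlonglongrightarrow> cis (\<Sum>v\<in>B. of_int (z x v) * \<theta>' v)"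
      by (intro tendsto_cis tendsto_sum tendsto_mult tendsto_const \<theta>')
    ultimately show "(\<lambda>k. cis (\<psi> (r k) x)) \<longlonglongrightarrow> cis (\<phi> x)" by simp
  qed
qed

section \<open>Sequential compactness of equivalence classes\<close>

text \<open>
  Dominated convergence for series: outside a finite set of indices all sequences have small tails
  because of the common bound \<open>a\<close>, and on a finite set pointwise convergence suffices.
\<close>

lemma infsum_square_diff_Cauchy:
  fixes b :: "nat \<Rightarrow> 'a \<Rightarrow> complex" and a :: "'a \<Rightarrow> complex"
  assumes summable: "(\<lambda>\<mu>. (norm (a \<mu>))\<^sup>2) summable_on UNIV"
    and bound: "\<And>k \<mu>. norm (b k \<mu>) \<le> norm (a \<mu>)"
    and lim: "\<And>\<mu>. (\<lambda>k. b k \<mu>) \<longlonglongrightarrow> L \<mu>"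
    and e: "e > 0"
  shows "\<exists>N. \<forall>m\<ge>N. \<forall>n\<ge>N. (\<Sum>\<^sub>\<infinity>\<mu>. (norm (b m \<mu> - b n \<mu>))\<^sup>2) < e"
proof -
  let ?a = "\<lambda>\<mu>. 4 * (norm (a \<mu>))\<^sup>2"
  define s where "s = infsum ?a UNIV"
  have sa: "?a summable_on UNIV" by (rule summable_on_cmult_right[OF summable])
  have "(?a has_sum s) UNIV" unfolding s_def using sa by (rule has_sum_infsum)
  then have "eventually (\<lambda>F. dist (sum ?a F) s < e / 2) (finite_subsets_at_top UNIV)"
    unfolding has_sum_def using e by (intro tendstoD) auto
  then obtain F where F: "finite F" "dist (sum ?a F) s < e / 2"
    unfolding eventually_finite_subsets_at_top by blast
  have sF: "?a summable_on (- F)" by (rule summable_on_subset_banach[OF sa]) simp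
  have tail: "infsum ?a (- F) < e / 2"
  proof -
    have "infsum ?a (F \<union> - F) = infsum ?a F + infsum ?a (- F)"
      using F sF by (intro infsum_Un_disjoint) auto
    then have "s = sum ?a F + infsum ?a (- F)" using F by (simp add: s_def)
    then show ?thesis using F(2) by (simp add: dist_real_def abs_less_iff)
  qed
  have "(\<lambda>k. \<Sum>\<mu>\<in>F. (norm (b k \<mu> - L \<mu>))\<^sup>2) \<longlonglongrightarrow> (\<Sum>\<mu>\<in>F. (norm (L \<mu> - L \<mu>))\<^sup>2)"
    by (intro tendsto_intros lim)
  then have "eventually (\<lambda>k. (\<Sum>\<mu>\<in>F. (norm (b k \<mu> - L \<mu>))\<^sup>2) < e / 8) sequentially"
    using e by (intro order_tendstoD) auto
  then obtain N where N: "\<And>k. k \<ge> N \<Longrightarrow> (\<Sum>\<mu>\<in>F. (norm (b k \<mu> - L \<mu>))\<^sup>2) < e / 8"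
    by (auto simp: eventually_sequentially)
  have "(\<Sum>\<^sub>\<infinity>\<mu>. (norm (b m \<mu> - b n \<mu>))\<^sup>2) < e" if mn: "m \<ge> N" "n \<ge> N" for m n
  proof -
    let ?d = "\<lambda>\<mu>. (norm (b m \<mu> - b n \<mu>))\<^sup>2"
    have le: "?d \<mu> \<le> ?a \<mu>" for \<mu>
    proof -
      have "norm (b m \<mu> - b n \<mu>) \<le> 2 * norm (a \<mu>)"
        using norm_triangle_ineq4[of "b m \<mu>" "b n \<mu>"] bound[of m \<mu>] bound[of n \<mu>] by linarith
      then have "?d \<mu> \<le> (2 * norm (a \<mu>))\<^sup>2" by (intro power_mono) auto
      then show ?thesis by (simp add: power_mult_distrib)
    qed
    have sd: "?d summable_on UNIV"
      by (rule summable_on_comparison_test[OF sa]) (use le in auto)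
    have "infsum ?d (F \<union> - F) = infsum ?d F + infsum ?d (- F)"
      using F by (intro infsum_Un_disjoint) (auto intro: summable_on_subset_banach[OF sd])
    then have "infsum ?d UNIV = sum ?d F + infsum ?d (- F)" using F by simp
    also have "infsum ?d (- F) \<le> infsum ?a (- F)"
      by (intro infsum_mono sF summable_on_subset_banach[OF sd]) (use le in auto)
    also have "sum ?d F \<le> (\<Sum>\<mu>\<in>F. 2 * (norm (b m \<mu> - L \<mu>))\<^sup>2 + 2 * (norm (b n \<mu> - L \<mu>))\<^sup>2)"
    proof (rule sum_mono)
      fix \<mu>
      show "?d \<mu> \<le> 2 * (norm (b m \<mu> - L \<mu>))\<^sup>2 + 2 * (norm (b n \<mu> - L \<mu>))\<^sup>2"
        using norm_add_square_le[of "b m \<mu> - L \<mu>" "L \<mu> - b n \<mu>"]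
        by (simp add: norm_minus_commute[of "L \<mu>"])
    qed
    also have "\<dots> = 2 * (\<Sum>\<mu>\<in>F. (norm (b m \<mu> - L \<mu>))\<^sup>2) + 2 * (\<Sum>\<mu>\<in>F. (norm (b n \<mu> - L \<mu>))\<^sup>2)"
      by (simp add: sum.distrib sum_distrib_left)
    finally show ?thesis using N[OF mn(1)] N[OF mn(2)] tail by linarith
  qed
  then show ?thesis by blast
qed

lemma Cauchy_if_coefficients_converge:
  fixes s :: "nat \<Rightarrow> real \<Rightarrow> complex"
  assumes s: "\<And>k. s k \<in> besicovitch_space 2" and f: "f \<in> besicovitch_space 2"
    and bound: "\<And>k \<mu>. norm (fourier_coeff (s k) \<mu>) \<le> norm (fourier_coeff f \<mu>)"
    and lim: "\<And>\<mu>. (\<lambda>k. fourier_coeff (s k) \<mu>) \<longlonglongrightarrow> L \<mu>"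
    and e: "e > 0"
  shows "\<exists>N. \<forall>m\<ge>N. \<forall>n\<ge>N. eventually (\<lambda>l. rms l (\<lambda>t. s m t - s n t) \<le> e) at_top"
proof -
  obtain N where N: "\<And>m n. m \<ge> N \<Longrightarrow> n \<ge> N \<Longrightarrow>
      (\<Sum>\<^sub>\<infinity>\<mu>. (norm (fourier_coeff (s m) \<mu> - fourier_coeff (s n) \<mu>))\<^sup>2) < e\<^sup>2"
    using infsum_square_diff_Cauchy[OF fourier_coeff_square_summable[OF f] bound lim, of "e\<^sup>2"] e by auto
  have "eventually (\<lambda>l. rms l (\<lambda>t. s m t - s n t) \<le> e) at_top" if "m \<ge> N" "n \<ge> N" for m n
  proof -
    have "eventually (\<lambda>l. mean_square l (\<lambda>t. s m t - s n t) < e\<^sup>2) at_top"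
      using N[OF that] by (intro order_tendstoD[OF parseval] besicovitch_space_diff s) (simp add: fourier_coeff_diff s)
    then show ?thesis by eventually_elim (use e in \<open>simp add: rms_le_iff\<close>)
  qed
  then show ?thesis by blast
qed

lemma fourier_coeff_limit:
  assumes s: "\<And>k. s k \<in> besicovitch_space 2" and g: "g \<in> besicovitch_space 2"
    and conv: "\<And>e. e > 0 \<Longrightarrow> \<exists>N. \<forall>n\<ge>N. eventually (\<lambda>l. rms l (\<lambda>t. s n t - g t) \<le> e) at_top"
  shows "(\<lambda>k. fourier_coeff (s k) \<mu>) \<longlonglongrightarrow> fourier_coeff g \<mu>"
proof (rule LIMSEQ_I)
  fix e :: real assume "e > 0"
  then obtain N where "\<And>n. n \<ge> N \<Longrightarrow> eventually (\<lambda>l. rms l (\<lambda>t. s n t - g t) \<le> e / 2) at_top"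
    using conv[of "e / 2"] by auto
  then have "norm (fourier_coeff (s n) \<mu> - fourier_coeff g \<mu>) \<le> e / 2" if "n \<ge> N" for n
    using norm_fourier_coeff_le[OF besicovitch_space_diff[OF s g], of n "e / 2" \<mu>] that
    unfolding fourier_coeff_diff[OF s g] by blast
  then show "\<exists>N. \<forall>n\<ge>N. norm (fourier_coeff (s n) \<mu> - fourier_coeff g \<mu>) < e"
    using \<open>e > 0\<close> by (intro exI[of _ N] allI impI) (auto intro: order.strict_trans1[of _ "e / 2"])
qed

lemma seminorm_tendsto_0:
  assumes s: "\<And>k. loc_L2 (s k)" and g: "loc_L2 g"
    and conv: "\<And>e. e > 0 \<Longrightarrow> \<exists>N. \<forall>n\<ge>N. eventually (\<lambda>l. rms l (\<lambda>t. s n t - g t) \<le> e) at_top"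
  shows "(\<lambda>n. besicovitch_seminorm 2 (\<lambda>t. s n t - g t)) \<longlonglongrightarrow> 0"
proof (rule order_tendstoI)
  fix a :: ennreal assume "0 < a"
  then obtain b where "0 < b" "b < a" using dense by blast
  then obtain e where e: "e > 0" "ennreal e < a" by (cases b) auto
  with conv obtain N where "\<And>n. n \<ge> N \<Longrightarrow> eventually (\<lambda>l. rms l (\<lambda>t. s n t - g t) \<le> e) at_top"
    by blast
  then have "besicovitch_seminorm 2 (\<lambda>t. s n t - g t) \<le> ennreal e" if "n \<ge> N" for n
    using e that by (intro seminorm_le loc_L2_diff s g) auto
  then show "eventually (\<lambda>n. besicovitch_seminorm 2 (\<lambda>t. s n t - g t) < a) sequentially"
    unfolding eventually_sequentially using e(2) by (meson order.strict_trans1)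
qed simp

lemma besicovitch_exponents_iff:
  "f \<in> besicovitch_exponents \<Lambda> lam \<longleftrightarrow>
     f \<in> besicovitch_space 2 \<and> (\<forall>\<mu>. \<mu> \<notin> \<Lambda> \<longrightarrow> fourier_coeff f \<mu> = 0)"
  unfolding besicovitch_exponents_def has_fourier_series_def by auto

text \<open>
  Equivalent functions differ by unimodular factors on the coefficients. This is what makes the
  coefficients of an equivalence class bounded, and their squares dominated by one summable family.
\<close>

lemma norm_fourier_coeff_equiv:
  assumes lam: "enumerates_exponents lam \<Lambda>" and fg: "(f, g) \<in> besicovitch_equiv \<Lambda> lam"
  shows "norm (fourier_coeff g \<mu>) = norm (fourier_coeff f \<mu>)"
proof (cases "\<mu> \<in> \<Lambda>")
  case True
  then obtain j where j: "j \<in> exponent_indices \<Lambda>" "\<mu> = lam j"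
    using lam unfolding enumerates_exponents_def bij_betw_def by blast
  then have "j \<in> {1..j}" by (simp add: exponent_indices_def)
  with fg j obtain \<psi> where "fourier_coeff g (lam j) = fourier_coeff f (lam j) * cis (\<psi> (lam j))"
    unfolding besicovitch_equiv_iff by blast
  then show ?thesis by (simp add: j norm_mult)
next
  case False
  with fg show ?thesis by (simp add: besicovitch_equiv_iff besicovitch_exponents_iff)
qed

text \<open>
  Equivalence classes are closed under limits of Fourier coefficients. For each \<open>n\<close> separately, the
  rational linear maps attached to the sequence are replaced by a limit of their characters along a
  subsequence that depends on \<open>n\<close>; the definition of equivalence does not ask the maps for different \<open>n\<close>
  to be compatible.
\<close>

lemma besicovitch_equiv_closed:
  assumes fs: "\<And>k. (f, s k) \<in> besicovitch_equiv \<Lambda> lam" and g: "g \<in> besicovitch_space 2"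
    and lim: "\<And>\<mu>. (\<lambda>k. fourier_coeff (s k) \<mu>) \<longlonglongrightarrow> fourier_coeff g \<mu>"
  shows "(f, g) \<in> besicovitch_equiv \<Lambda> lam"
  unfolding besicovitch_equiv_iff
proof (intro conjI ballI)
  show "f \<in> besicovitch_exponents \<Lambda> lam" using fs by (simp add: besicovitch_equiv_iff)
  show "g \<in> besicovitch_exponents \<Lambda> lam"
    unfolding besicovitch_exponents_iff
  proof (intro conjI allI impI g)
    fix \<mu> assume "\<mu> \<notin> \<Lambda>"
    then have "fourier_coeff (s k) \<mu> = 0" for k
      using fs by (simp add: besicovitch_equiv_iff besicovitch_exponents_iff)
    with lim[of \<mu>] show "fourier_coeff g \<mu> = 0" by (simp add: LIMSEQ_const_iff)
  qed
  fix n assume n: "n \<in> exponent_indices \<Lambda>"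
  have "\<forall>k. \<exists>\<psi>. rat_linear_on (rat_span (lam ` {1..n})) \<psi> \<and>
      (\<forall>j\<in>{1..n}. fourier_coeff (s k) (lam j) = fourier_coeff f (lam j) * cis (\<psi> (lam j)))"
    using fs n unfolding besicovitch_equiv_iff by blast
  then obtain \<psi> where \<psi>: "\<And>k. rat_linear_on (rat_span (lam ` {1..n})) (\<psi> k)"
    and coeff: "\<And>k j. j \<in> {1..n} \<Longrightarrow>
      fourier_coeff (s k) (lam j) = fourier_coeff f (lam j) * cis (\<psi> k (lam j))"
    by metis
  obtain r \<phi> where r: "strict_mono r" and \<phi>: "rat_linear_on (rat_span (lam ` {1..n})) \<phi>"
    and cis_lim: "\<And>x. x \<in> lam ` {1..n} \<Longrightarrow> (\<lambda>k. cis (\<psi> (r k) x)) \<longlonglongrightarrow> cis (\<phi> x)"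
    using rational_characters_seq_compact[of "lam ` {1..n}" \<psi>] \<psi> by blast
  have "fourier_coeff g (lam j) = fourier_coeff f (lam j) * cis (\<phi> (lam j))" if j: "j \<in> {1..n}" for j
  proof (rule LIMSEQ_unique)
    show "(\<lambda>k. fourier_coeff (s (r k)) (lam j)) \<longlonglongrightarrow> fourier_coeff g (lam j)"
      using LIMSEQ_subseq_LIMSEQ[OF lim r] by (simp add: o_def)
    show "(\<lambda>k. fourier_coeff (s (r k)) (lam j)) \<longlonglongrightarrow> fourier_coeff f (lam j) * cis (\<phi> (lam j))"
      unfolding coeff[OF j] using j by (intro tendsto_mult tendsto_const cis_lim) auto
  qed
  with \<phi> show "\<exists>\<psi>. rat_linear_on (rat_span (lam ` {1..n})) \<psi> \<and>
      (\<forall>j\<in>{1..n}. fourier_coeff g (lam j) = fourier_coeff f (lam j) * cis (\<psi> (lam j)))"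
    by blast
qed

theorem proposition4:
  fixes \<Lambda> :: "real set" and lam :: "nat \<Rightarrow> real" and G :: "(real \<Rightarrow> complex) set"
  assumes "countable \<Lambda>"
    and "enumerates_exponents lam \<Lambda>"
    and "G \<in> besicovitch_exponents \<Lambda> lam // besicovitch_equiv \<Lambda> lam"
  shows "besicovitch_seq_compact 2 G"
proof -
  obtain f where f: "f \<in> besicovitch_exponents \<Lambda> lam" and G: "G = besicovitch_equiv \<Lambda> lam `` {f}"
    using assms(3) by (rule quotientE)
  have fB: "f \<in> besicovitch_space 2" using f by (simp add: besicovitch_exponents_iff)
  have G_sub: "G \<subseteq> besicovitch_space 2"
    by (auto simp: G besicovitch_equiv_iff besicovitch_exponents_iff)
  have "\<exists>g\<in>G. \<exists>r. strict_mono r \<and> (\<lambda>n. besicovitch_seminorm 2 (\<lambda>t. s (r n) t - g t)) \<longlonglongrightarrow> 0"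
    if "\<forall>n. s n \<in> G" for s :: "nat \<Rightarrow> real \<Rightarrow> complex"
  proof -
    have fs: "(f, s k) \<in> besicovitch_equiv \<Lambda> lam" and sB: "s k \<in> besicovitch_space 2" for k
      using that G_sub by (auto simp: G)
    have norm_s: "norm (fourier_coeff (s k) \<mu>) = norm (fourier_coeff f \<mu>)" for k \<mu>
      by (rule norm_fourier_coeff_equiv[OF assms(2) fs])
    define M where "M = sqrt (\<Sum>\<^sub>\<infinity>\<mu>. (norm (fourier_coeff f \<mu>))\<^sup>2)"
    have "norm (fourier_coeff (s k) \<mu>) \<le> M" for k \<mu>
      unfolding norm_s M_def
      using finite_sum_le_infsum[OF fourier_coeff_square_summable[OF fB], of "{\<mu>}"]
      by (intro real_le_rsqrt) simp
    then obtain r where r: "strict_mono r"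
      and ex: "\<And>\<mu>. \<mu> \<in> \<Lambda> \<Longrightarrow> \<exists>L. (\<lambda>k. fourier_coeff (s (r k)) \<mu>) \<longlonglongrightarrow> L"
      using function_convergent_subsequence[OF assms(1), of "\<lambda>k. fourier_coeff (s k)" M] by metis
    have "\<exists>L. (\<lambda>k. fourier_coeff (s (r k)) \<mu>) \<longlonglongrightarrow> L" for \<mu>
    proof (cases "\<mu> \<in> \<Lambda>")
      case False
      then have "fourier_coeff (s k) \<mu> = 0" for k
        using fs by (simp add: besicovitch_equiv_iff besicovitch_exponents_iff)
      then show ?thesis by auto
    qed (rule ex)
    then obtain L where L: "\<And>\<mu>. (\<lambda>k. fourier_coeff (s (r k)) \<mu>) \<longlonglongrightarrow> L \<mu>" by metis
    obtain g where g: "g \<in> besicovitch_space 2" and conv: "\<And>e. e > 0 \<Longrightarrow>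
        \<exists>N. \<forall>n\<ge>N. eventually (\<lambda>l. rms l (\<lambda>t. s (r n) t - g t) \<le> e) at_top"
    proof (rule besicovitch_space_complete[of "\<lambda>k. s (r k)"])
      show "\<exists>N. \<forall>m\<ge>N. \<forall>n\<ge>N. eventually (\<lambda>l. rms l (\<lambda>t. s (r m) t - s (r n) t) \<le> e) at_top"
        if "e > 0" for e
        by (rule Cauchy_if_coefficients_converge[where f = f and L = L])
           (simp_all add: sB fB norm_s L that)
    qed (use sB in auto)
    have "(f, g) \<in> besicovitch_equiv \<Lambda> lam"
      using fourier_coeff_limit[of "\<lambda>k. s (r k)", OF sB g conv]
      by (rule besicovitch_equiv_closed[of f "\<lambda>k. s (r k)", OF fs g])
    moreover have "(\<lambda>n. besicovitch_seminorm 2 (\<lambda>t. s (r n) t - g t)) \<longlonglongrightarrow> 0"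
      using seminorm_tendsto_0[of "\<lambda>k. s (r k)", OF besicovitch_space_loc_L2[OF sB]
          besicovitch_space_loc_L2[OF g] conv] .
    ultimately show ?thesis using r by (auto simp: G)
  qed
  with G_sub show ?thesis unfolding besicovitch_seq_compact_def by blast
qed

end
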